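(* Let $p,q$ be natural numbers and let $T=T_v$ with $v=\{(p_n,\ell_n,q_n,m_n):n\in\mathbb N\}\in\mathcal V$. If the set $\{n\in\mathbb N:\ p\,q_n-q\,p_n=0\}$ is infinite and the set $\{n\in\mathbb N:\ 0\neq|p\,q_n-q\,p_n|\le (p+q)h_n\}$ is finite, then $T^p\times T^q$ is conservative and not ergodic.
   Context: Rank-one construction (cutting and stacking): let $a_n,b_n,c_n,d_n$ ($n\ge 0$) be sequences of positive integers. Let $G_0$ be the unit interval $[0,1)$, a column of height $H_0=1$ (set $h_0=1$). Given the column $G_n$ of height $H_n$, form $G_{n+1}$ by cutting $G_n$ into four subcolumns of equal width, placing $a_n,b_n,c_n,d_n$ spacers on top of the first, second, third and fourth subcolumns respectively, and stacking the subcolumns from left to right. This defines a Lebesgue-measure-preserving invertible transformation $T$ on a subset of $\mathbb R$ with Lebesgue measure $\mu$. Put $p_n=H_n+a_n$, $\ell_n=H_n+b_n$, $q_n=H_n+c_n$, $m_n=H_n+d_n$ and $h_{n+1}=p_n+\ell_n+q_n+H_n$. Write $T=T_v$ with $v=\{(p_n,\ell_n,q_n,m_n)\}$. $\mathcal W$ is the set of such $v$ with $\lim p_n/h_n=\infty$, $\ell_n>n(p_n+q_n+2h_n)$ and $m_n>n\,h_{n+1}$ for all $n$; $\mathcal V=\{v\in\mathcal W: p_n\le q_n \text{ for all } n\}$. A measure-preserving $S$ is conservative if for every set $A$ of positive measure there is $n\ge1$ with $\mu(S^{-n}A\cap A)>0$. *)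

theory Defs
  imports "HOL-Analysis.Analysis"
begin

text \<open>Rank-one (cutting and stacking) construction with four subcolumns.
  A parameter sequence v n = (p_n, l_n, q_n, m_n).\<close>

type_synonym rk_params = "nat \<Rightarrow> nat \<times> nat \<times> nat \<times> nat"

definition pp :: "rk_params \<Rightarrow> nat \<Rightarrow> nat" where "pp v n = fst (v n)"
definition ll :: "rk_params \<Rightarrow> nat \<Rightarrow> nat" where "ll v n = fst (snd (v n))"
definition qq :: "rk_params \<Rightarrow> nat \<Rightarrow> nat" where "qq v n = fst (snd (snd (v n)))"
definition mm :: "rk_params \<Rightarrow> nat \<Rightarrow> nat" where "mm v n = snd (snd (snd (v n)))"

text \<open>Height H_n of column G_n: H_0 = 1, H_{n+1} = p_n + l_n + q_n + m_n.\<close>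
fun HH :: "rk_params \<Rightarrow> nat \<Rightarrow> nat" where
  "HH v 0 = 1"
| "HH v (Suc n) = pp v n + ll v n + qq v n + mm v n"

fun hh :: "rk_params \<Rightarrow> nat \<Rightarrow> nat" where
  "hh v 0 = 1"
| "hh v (Suc n) = pp v n + ll v n + qq v n + HH v n"

definition sa :: "rk_params \<Rightarrow> nat \<Rightarrow> nat" where "sa v n = pp v n - HH v n"
definition sb :: "rk_params \<Rightarrow> nat \<Rightarrow> nat" where "sb v n = ll v n - HH v n"
definition sc :: "rk_params \<Rightarrow> nat \<Rightarrow> nat" where "sc v n = qq v n - HH v n"
definition sd :: "rk_params \<Rightarrow> nat \<Rightarrow> nat" where "sd v n = mm v n - HH v n"

text \<open>v comes from positive integer spacer sequences a_n,b_n,c_n,d_n.\<close>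
definition rk_valid :: "rk_params \<Rightarrow> bool" where
  "rk_valid v \<longleftrightarrow> (\<forall>n. HH v n < pp v n \<and> HH v n < ll v n \<and> HH v n < qq v n \<and> HH v n < mm v n)"

definition inW :: "rk_params \<Rightarrow> bool" where
  "inW v \<longleftrightarrow> rk_valid v
     \<and> filterlim (\<lambda>n. real (pp v n) / real (hh v n)) at_top sequentially
     \<and> (\<forall>n. ll v n > n * (pp v n + qq v n + 2 * hh v n))
     \<and> (\<forall>n. mm v n > n * hh v (Suc n))"

definition inV :: "rk_params \<Rightarrow> bool" where
  "inV v \<longleftrightarrow> inW v \<and> (\<forall>n. pp v n \<le> qq v n)"

definition wid :: "nat \<Rightarrow> real" where "wid n = 1 / 4 ^ n"

text \<open>Left end of the unused part of the real line before stage n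
  (spacers of stage n are taken consecutively from here).\<close>
definition fresh :: "rk_params \<Rightarrow> nat \<Rightarrow> real" where
  "fresh v n = 1 + (\<Sum>k<n. real (sa v k + sb v k + sc v k + sd v k) * wid (Suc k))"

definition spacers :: "real \<Rightarrow> real \<Rightarrow> nat \<Rightarrow> real list" where
  "spacers x0 w k = map (\<lambda>i. x0 + real i * w) [0..<k]"

text \<open>Column G_n as the list (bottom to top) of left endpoints of its levels;
  level j is the interval [col v n ! j, col v n ! j + wid n).\<close>
fun col :: "rk_params \<Rightarrow> nat \<Rightarrow> real list" where
  "col v 0 = [0]"
| "col v (Suc n) =
    (let w = wid (Suc n); s = fresh v n; C = col v n;
         A = real (sa v n); B = real (sb v n); Cc = real (sc v n) in
       C @ spacers s w (sa v n)
       @ map (\<lambda>x. x + w) C @ spacers (s + A * w) w (sb v n)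
       @ map (\<lambda>x. x + 2 * w) C @ spacers (s + (A + B) * w) w (sc v n)
       @ map (\<lambda>x. x + 3 * w) C @ spacers (s + (A + B + Cc) * w) w (sd v n))"

definition level :: "rk_params \<Rightarrow> nat \<Rightarrow> nat \<Rightarrow> real set" where
  "level v n j = {col v n ! j ..< col v n ! j + wid n}"

definition Xsp :: "rk_params \<Rightarrow> real set" where
  "Xsp v = (\<Union>n. \<Union>j<length (col v n). level v n j)"

text \<open>T_v maps each non-top level of each column by translation onto the level above;
  it is the identity elsewhere (outside X, a set where it plays no role).\<close>
definition Tv :: "rk_params \<Rightarrow> real \<Rightarrow> real" where
  "Tv v x = (if \<exists>n j. Suc j < length (col v n) \<and> x \<in> level v n j
     then (let (n, j) = (SOME (n, j). Suc j < length (col v n) \<and> x \<in> level v n j)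
           in x + (col v n ! Suc j - col v n ! j))
     else x)"

definition muX :: "rk_params \<Rightarrow> real measure" where
  "muX v = restrict_space lborel (Xsp v)"

definition conservative :: "'a measure \<Rightarrow> ('a \<Rightarrow> 'a) \<Rightarrow> bool" where
  "conservative M S \<longleftrightarrow>
     (\<forall>A\<in>sets M. emeasure M A > 0 \<longrightarrow> (\<exists>n\<ge>1. emeasure M ((S ^^ n) -` A \<inter> A) > 0))"

definition ergodic :: "'a measure \<Rightarrow> ('a \<Rightarrow> 'a) \<Rightarrow> bool" where
  "ergodic M S \<longleftrightarrow>
     (\<forall>A\<in>sets M. S -` A \<inter> space M = A \<longrightarrow> emeasure M A = 0 \<or> emeasure M (space M - A) = 0)"

end

theory Submission
  imports Defs
begin

text \<open>
  Write \<open>I\<^sub>n x\<close> for the height of the level of \<open>G\<^sub>n\<close> that contains \<open>x\<close>. A point of \<open>G\<^sub>n\<close> satisfies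
  \<open>I\<^sub>n\<^sub>+\<^sub>1 x - I\<^sub>n x \<in> {0, p\<^sub>n, p\<^sub>n + l\<^sub>n, p\<^sub>n + l\<^sub>n + q\<^sub>n}\<close>, and \<open>I\<^sub>n (T x) = I\<^sub>n x + 1\<close> for all large \<open>n\<close>.

  Conservativity: conservativity passes to powers, so \<open>p\<close> and \<open>q\<close> may be taken coprime. If
  \<open>p q\<^sub>n = q p\<^sub>n\<close>, then \<open>p\<^sub>n = p s\<close>, \<open>q\<^sub>n = q s\<close>, and the \<open>s\<close>-th iterate of \<open>T\<^sup>p \<times> T\<^sup>q\<close> maps a
  sixteenth of every product of two levels of \<open>G\<^sub>n\<close> onto another sixteenth of it. A set of positive
  measure almost fills some such product with \<open>n\<close> in the given infinite set.

  Non-ergodicity: \<open>F\<^sub>n (x, y) = q I\<^sub>n x - p I\<^sub>n y\<close> is, for large \<open>n\<close>, unchanged by \<open>T\<^sup>p \<times> T\<^sup>q\<close>, so any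
  condition on the tail of \<open>F\<^sub>n\<close> defines an invariant set. For points of \<open>G\<^sub>M \<times> G\<^sub>M\<close> with \<open>M\<close> large, the
  growth conditions and the gap hypothesis force \<open>F\<^sub>n z = F\<^sub>n z'\<close> to descend to
  \<open>F\<^sub>M\<^sub>+\<^sub>1 z = F\<^sub>M\<^sub>+\<^sub>1 z'\<close>; hence points with different \<open>F\<^sub>M\<^sub>+\<^sub>1\<close> are separated by invariant sets.
\<close>

section \<open>Recurrence of powers\<close>

text \<open>Iterating recurrence gives return times whose partial sums all lead back to the set; two of
  these sums agree modulo \<open>g\<close>.\<close>

lemma conservative_power:
  assumes "conservative M S" and S: "S \<in> measurable M M" and "0 < g"
  shows "conservative M (S ^^ g)"
  unfolding conservative_def
proof (intro ballI impI)
  fix A assume A: "A \<in> sets M" "0 < emeasure M A"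
  define good where "good = (\<lambda>B. B \<in> sets M \<and> 0 < emeasure M B)"
  define step where "step = (\<lambda>B B'. \<exists>n\<ge>1. B' = (S ^^ n) -` B \<inter> B)"
  have ex: "\<exists>B'. good B' \<and> step B B'" if "good B" for B
  proof -
    obtain n where n: "n \<ge> 1" "emeasure M ((S ^^ n) -` B \<inter> B) > 0"
      using assms(1) \<open>good B\<close> unfolding conservative_def good_def by blast
    have "(S ^^ n) -` B \<inter> B = ((S ^^ n) -` B \<inter> space M) \<inter> B"
      using \<open>good B\<close> sets.sets_into_space by (auto simp: good_def)
    also have "\<dots> \<in> sets M"
      using \<open>good B\<close> S by (auto simp: good_def intro!: sets.Int measurable_sets[OF measurable_compose_n])
    finally show ?thesis using n by (auto simp: good_def step_def)
  qed
  \<comment> \<open>Dependent choice gives a decreasing chain from \<open>A\<close>: each set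
    consists of the points of its predecessor that come back to the predecessor after a fixed time
    \<open>t n\<close>.\<close>
  have "\<exists>f. \<forall>n. (good (f n) \<and> (n = 0 \<longrightarrow> f n = A)) \<and> step (f n) (f (Suc n))"
    by (rule dependent_nat_choice) (use A ex in \<open>auto simp: good_def\<close>)
  then obtain f where f: "\<And>n. good (f n)" "f 0 = A" "\<And>n. step (f n) (f (Suc n))" by blast
  then obtain t where t: "\<And>n. t n \<ge> (1::nat)" "\<And>n. f (Suc n) = (S ^^ t n) -` f n \<inter> f n"
    unfolding step_def by metis
  define s where "s n = (\<Sum>k<n. t k)" for n
  have ret: "f n \<subseteq> f m \<inter> (S ^^ (s n - s m)) -` f m" if "m \<le> n" for m n
    using that
  proof (induction n rule: dec_induct)
    case (step n)
    have "s m \<le> s n" unfolding s_def using step(1) by (intro sum_mono2) auto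
    then have e: "s (Suc n) - s m = (s n - s m) + t n" by (simp add: s_def)
    show ?case
      unfolding t(2) e using step.IH by (auto simp: funpow_add)
  qed auto
  \<comment> \<open>Pigeonhole: the \<open>g + 1\<close> partial sums \<open>s 0, ..., s g\<close>
    have only \<open>g\<close> possible residues.\<close>
  have "\<not> inj_on (\<lambda>n. s n mod g) {..g}"
  proof
    assume "inj_on (\<lambda>n. s n mod g) {..g}"
    then have "card {..g} \<le> card {..<g}"
      by (rule card_inj_on_le) (use \<open>0 < g\<close> in auto)
    then show False by simp
  qed
  then obtain m n where mn: "m < n" "s m mod g = s n mod g"
    unfolding inj_on_def by (metis linorder_neqE_nat)
  have lt: "s m < s n"
  proof -
    have "s (Suc m) \<le> s n" unfolding s_def using mn(1) by (intro sum_mono2) auto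
    then show ?thesis using t(1)[of m] by (simp add: s_def)
  qed
  then obtain c where c: "s n - s m = g * c"
    using mn(2) mod_eq_dvd_iff_nat[of "s m" "s n" g] by (auto simp: dvd_def)
  have "f n \<subseteq> A \<inter> (S ^^ (s n - s m)) -` f m"
    using ret[of 0 n] ret[of m n] mn(1) f(2) by auto
  also have "\<dots> \<subseteq> ((S ^^ g) ^^ c) -` A \<inter> A"
    using ret[of 0 m] f(2) unfolding c funpow_mult by auto
  finally have sub: "f n \<subseteq> ((S ^^ g) ^^ c) -` A \<inter> A" .
  have "((S ^^ g) ^^ c) -` A \<inter> A = (((S ^^ g) ^^ c) -` A \<inter> space M) \<inter> A"
    using A sets.sets_into_space by auto
  also have "\<dots> \<in> sets M"
    using A S by (auto intro!: sets.Int measurable_sets[OF measurable_compose_n])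
  finally have "emeasure M (f n) \<le> emeasure M (((S ^^ g) ^^ c) -` A \<inter> A)"
    by (intro emeasure_mono sub)
  then have "0 < emeasure M (((S ^^ g) ^^ c) -` A \<inter> A)"
    using f(1)[of n] by (auto simp: good_def intro: less_le_trans)
  moreover have "c \<ge> 1" using c lt by (cases c) auto
  ultimately show "\<exists>n\<ge>1. 0 < emeasure M (((S ^^ g) ^^ n) -` A \<inter> A)" by blast
qed

section \<open>Arithmetic of offsets\<close>

text \<open>The case \<open>p = q\<close> of the descent. For fixed \<open>x\<close>, two different
  admissible values are apart by at least one of \<open>P\<close>, \<open>Q\<close> or, if
  \<open>Q\<close> differs from \<open>P\<close>, \<open>Q - P\<close>; each of these exceeds
  \<open>2 * h\<close>.\<close>

lemma gap_cases_equal: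
  fixes u w x P Q h :: int
  shows "2 * h < P \<Longrightarrow> Q = P \<or> P + 2 * h < Q \<Longrightarrow> 0 < h \<Longrightarrow>
    x = 0 \<and> (u = 0 \<or> u = P \<or> u = -P \<or> u = Q \<or> u = -Q) \<or> x = 1 \<and> (u = 0 \<or> u = P \<or> u = Q \<or> u = P + Q)
      \<or> x = -1 \<and> (u = 0 \<or> u = -P \<or> u = -Q \<or> u = -P - Q) \<Longrightarrow>
    x = 0 \<and> (w = 0 \<or> w = P \<or> w = -P \<or> w = Q \<or> w = -Q) \<or> x = 1 \<and> (w = 0 \<or> w = P \<or> w = Q \<or> w = P + Q)
      \<or> x = -1 \<and> (w = 0 \<or> w = -P \<or> w = -Q \<or> w = -P - Q) \<Longrightarrow>
    u - w \<le> 2 * h \<Longrightarrow> w - u \<le> 2 * h \<Longrightarrow> u = w"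
  by (elim disjE conjE; linarith)

text \<open>The case \<open>p < q\<close> of the descent. Products such as \<open>q * u\<close> and
  \<open>p * Q\<close> are single variables here, so that linear arithmetic settles every case.
  Apart from \<open>0 = 0\<close>, the only coincidence allowed is \<open>p * Q = q * P\<close> with
  equal signs; any other pair of values is more than \<open>k\<close> apart.\<close>

lemma gap_cases_less:
  fixes qu pw pP qP pQ qQ P k :: int
  shows "qu = 0 \<or> qu = qP \<or> qu = - qP \<or> qu = qQ \<or> qu = - qQ \<Longrightarrow>
    pw = 0 \<or> pw = pP \<or> pw = - pP \<or> pw = pQ \<or> pw = - pQ \<Longrightarrow>
    pP + P \<le> qP \<Longrightarrow> pQ + P \<le> qQ \<Longrightarrow> pP \<le> pQ \<Longrightarrow> qP \<le> qQ \<Longrightarrow> P \<le> pP \<Longrightarrow> 0 < k \<Longrightarrow> k < P \<Longrightarrow>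
    pQ = qP \<or> pQ + k < qP \<or> qP + k < pQ \<Longrightarrow> qu - pw \<le> k \<Longrightarrow> pw - qu \<le> k \<Longrightarrow> qu = pw"
  by (elim disjE; linarith)

text \<open>\<open>L\<close> dominates, so its coefficients must cancel first; what remains is a combination of
  \<open>p P, p Q, q P, q Q\<close> which is either zero or too large to be compensated by \<open>D\<close> and \<open>E\<close>.\<close>

lemma offset_descent:
  fixes p q P Q L h D E :: int and a a' b b' :: nat
  assumes pq: "0 < p" "p \<le> q" and h: "0 < h" and PQ: "P \<le> Q" "(p + q) * h < P"
    and L: "(p + q) * (P + Q + 2 * h) < L"
    and gap: "p * Q = q * P \<or> (p + q) * h < \<bar>p * Q - q * P\<bar>"
    and DE: "\<bar>D\<bar> < h" "\<bar>E\<bar> < h"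
    and off_eq: "\<And>i. off i = (if i = 0 then 0 else if i = 1 then P else if i = 2 then P + L else P + L + Q)"
    and eq: "q * (D + off a' - off a) = p * (E + off b' - off b)"
  shows "q * D = p * E"
proof -
  \<comment> \<open>An offset is split into its multiple of the dominant \<open>L\<close> and a
    remainder built from \<open>P\<close> and \<open>Q\<close>.\<close>
  define s where "s i = (if i < 2 then 0 else 1::int)" for i :: nat
  define r where "r i = (if i = 0 then 0 else if i = 1 \<or> i = 2 then P else P + Q)" for i :: nat
  have o: "off i = s i * L + r i" for i by (auto simp: off_eq s_def r_def)
  have "0 < (p + q) * h" using pq h by simp
  then have P0: "0 < P" using PQ by linarith
  define x where "x = s a' - s a"
  define y where "y = s b' - s b"
  define u where "u = r a' - r a"
  define w where "w = r b' - r b"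
  have shape: "s i' - s i = 0 \<and> (r i' - r i = 0 \<or> r i' - r i = P \<or> r i' - r i = -P \<or> r i' - r i = Q \<or> r i' - r i = -Q)
      \<or> s i' - s i = 1 \<and> (r i' - r i = 0 \<or> r i' - r i = P \<or> r i' - r i = Q \<or> r i' - r i = P + Q)
      \<or> s i' - s i = -1 \<and> (r i' - r i = 0 \<or> r i' - r i = -P \<or> r i' - r i = -Q \<or> r i' - r i = -P - Q)" for i i'
    unfolding s_def r_def by simp
  note shape_u = shape[of a' a, folded x_def u_def] and shape_w = shape[of b' b, folded y_def w_def]
  have xy: "x \<in> {-1, 0, 1}" "y \<in> {-1, 0, 1}" by (auto simp: x_def y_def s_def)
  have uw: "\<bar>u\<bar> \<le> P + Q" "\<bar>w\<bar> \<le> P + Q" using P0 PQ(1) by (auto simp: u_def w_def r_def)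
  have main: "(q * x - p * y) * L + (q * u - p * w) + (q * D - p * E) = 0"
    using eq unfolding o x_def y_def u_def w_def by (simp add: algebra_simps)
  have bd: "\<bar>q * c - p * d\<bar> \<le> (p + q) * B" if "\<bar>c\<bar> \<le> B" "\<bar>d\<bar> \<le> B" for c d B
  proof -
    have "\<bar>q * c - p * d\<bar> \<le> q * \<bar>c\<bar> + p * \<bar>d\<bar>"
      using abs_triangle_ineq4[of "q * c" "p * d"] pq by (simp add: abs_mult)
    also have "\<dots> \<le> q * B + p * B" using that pq by (intro add_mono mult_left_mono) auto
    finally show ?thesis by (simp add: algebra_simps)
  qed
  have b1: "\<bar>q * u - p * w\<bar> \<le> (p + q) * (P + Q)" by (rule bd[OF uw])
  have b2: "\<bar>q * D - p * E\<bar> \<le> (p + q) * h" using DE by (intro bd) auto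
  have K: "q * x - p * y = 0"
  proof (rule ccontr)
    assume "q * x - p * y \<noteq> 0"
    then have "1 * \<bar>L\<bar> \<le> \<bar>q * x - p * y\<bar> * \<bar>L\<bar>" by (intro mult_right_mono) auto
    also have "\<dots> = \<bar>(q * u - p * w) + (q * D - p * E)\<bar>"
      using main unfolding abs_mult[symmetric] by linarith
    also have "\<dots> \<le> (p + q) * (P + Q) + (p + q) * h" using b1 b2 by linarith
    also have "\<dots> \<le> (p + q) * (P + Q + 2 * h)" using \<open>0 < (p + q) * h\<close> by (simp add: algebra_simps)
    finally show False using L by simp
  qed
  have U: "q * u - p * w = - (q * D - p * E)" using main K by simp
  then have bU: "\<bar>q * u - p * w\<bar> \<le> (p + q) * h" using b2 by simp
  have "q * u - p * w = 0"
  proof (cases "p = q")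
    case True
    \<comment> \<open>Here \<open>x\<close> may be nonzero, but \<open>u\<close> and
      \<open>w\<close> then range over the same list of values.\<close>
    have xy': "x = y" using K True pq by simp
    have "\<bar>p * (u - w)\<bar> \<le> p * (2 * h)"
      using bU True by (simp add: algebra_simps)
    then have "p * \<bar>u - w\<bar> \<le> p * (2 * h)" using pq(1) by (simp add: abs_mult)
    then have uw': "\<bar>u - w\<bar> \<le> 2 * h" using pq by simp
    have "1 * (2 * h) \<le> p * (2 * h)" using pq h by (intro mult_right_mono) auto
    then have hP: "2 * h < P" using PQ(2) True by simp
    have gapPQ: "Q = P \<or> P + 2 * h < Q"
    proof (cases "Q = P")
      case False
      then have "p * Q \<noteq> q * P" using True pq by simp
      then have "p * (2 * h) < \<bar>p * (Q - P)\<bar>" using gap True by (simp add: algebra_simps)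
      then have "2 * h < \<bar>Q - P\<bar>" using pq by (simp add: abs_mult)
      then show ?thesis using PQ(1) by linarith
    qed simp
    have "u - w \<le> 2 * h" "w - u \<le> 2 * h" using uw' by auto
    then have "u = w"
      by (rule gap_cases_equal[OF hP gapPQ h shape_u shape_w[folded xy']])
    then show ?thesis using True by simp
  next
    case False
    then have "p < q" using pq by simp
    \<comment> \<open>If \<open>x\<close> were nonzero, \<open>q * x = p * y\<close> would need a
      \<open>y\<close> of absolute value greater than 1.\<close>
    have "x = 0" using xy K \<open>p < q\<close> pq by auto
    moreover from this have "y = 0" using K pq by simp
    ultimately have u: "u = 0 \<or> u = P \<or> u = -P \<or> u = Q \<or> u = -Q"
      and w: "w = 0 \<or> w = P \<or> w = -P \<or> w = Q \<or> w = -Q"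
      using shape_u shape_w by simp_all
    have m: "p * P + P \<le> q * P" "p * Q + Q \<le> q * Q"
      using \<open>p < q\<close> P0 PQ(1) mult_right_mono[of "p + 1" q P] mult_right_mono[of "p + 1" q Q]
      by (auto simp: algebra_simps)
    have m2: "p * P \<le> p * Q" "q * P \<le> q * Q" "P \<le> p * P"
      using pq P0 PQ(1) by (auto intro: mult_left_mono)
    have g: "p * Q = q * P \<or> p * Q + (p + q) * h < q * P \<or> q * P + (p + q) * h < p * Q"
      using gap by linarith
    have b: "q * u - p * w \<le> (p + q) * h" "p * w - q * u \<le> (p + q) * h" using bU by auto
    have "q * u = 0 \<or> q * u = q * P \<or> q * u = - (q * P) \<or> q * u = q * Q \<or> q * u = - (q * Q)"
      "p * w = 0 \<or> p * w = p * P \<or> p * w = - (p * P) \<or> p * w = p * Q \<or> p * w = - (p * Q)"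
      using u w by (elim disjE; simp)+
    then have "q * u = p * w"
      using m(1) m(2)[THEN order_trans[OF add_left_mono[OF PQ(1)]]] m2(1-3) \<open>0 < (p + q) * h\<close> PQ(2) g b
      by (rule gap_cases_less)
    then show ?thesis by simp
  qed
  then show ?thesis using U by simp
qed

section \<open>Levels of the columns\<close>

text \<open>Height at which the copy of \<open>G\<^sub>n\<close> from subcolumn \<open>i = 0, 1, 2, 3\<close> starts in \<open>G\<^sub>n\<^sub>+\<^sub>1\<close>.\<close>

definition offset :: "rk_params \<Rightarrow> nat \<Rightarrow> nat \<Rightarrow> nat" where
  "offset v n i = (if i = 0 then 0 else if i = 1 then pp v n else if i = 2 then pp v n + ll v n
     else pp v n + ll v n + qq v n)"

locale rank_one =
  fixes v :: rk_params
  assumes valid: "rk_valid v"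
begin

lemma heights:
  "HH v n < pp v n" "HH v n < ll v n" "HH v n < qq v n" "HH v n < mm v n"
  using valid by (auto simp: rk_valid_def)

lemma HH_pos: "0 < HH v n"
  using heights(1)[of "n - 1"] by (cases n) auto

lemma wid_pos: "0 < wid n" and wid_Suc: "wid n = 4 * wid (Suc n)"
  by (auto simp: wid_def)

lemma length_col: "length (col v n) = HH v n"
proof (induction n)
  case (Suc n)
  then show ?case
    using heights[of n] by (simp add: Let_def spacers_def sa_def sb_def sc_def sd_def)
qed simp

text \<open>The part of the line used before stage \<open>n\<close> has exactly the total length of
  the levels of \<open>G_n\<close>: each stage adds \<open>H_(n+1) - 4 H_n\<close> spacers, and
  cutting preserves length.\<close>

lemma fresh_eq: "fresh v n = real (HH v n) * wid n"
proof (induction n)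
  case 0
  then show ?case by (simp add: fresh_def wid_def)
next
  case (Suc n)
  have "fresh v (Suc n) = fresh v n + real (sa v n + sb v n + sc v n + sd v n) * wid (Suc n)"
    by (simp add: fresh_def)
  also have "sa v n + sb v n + sc v n + sd v n = HH v (Suc n) - 4 * HH v n"
    using heights[of n] by (simp add: sa_def sb_def sc_def sd_def)
  also have "real \<dots> = real (HH v (Suc n)) - 4 * real (HH v n)"
    using heights[of n] by (simp add: of_nat_diff)
  also have "fresh v n = 4 * real (HH v n) * wid (Suc n)"
    unfolding Suc.IH wid_Suc[of n] by simp
  finally show ?case by (simp add: algebra_simps)
qed

text \<open>With their spacers the first three blocks of the new column have lengths
  \<open>p_n\<close>, \<open>l_n\<close>, \<open>q_n\<close>, so \<open>offset\<close> marks where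
  each copy begins; copy \<open>i\<close> lies \<open>i\<close> quarter-widths to the right of the
  old level.\<close>

lemma col_Suc_nth:
  assumes "j < HH v n" "i < 4"
  shows "col v (Suc n) ! (j + offset v n i) = col v n ! j + real i * wid (Suc n)"
proof -
  have sp: "length (spacers x w k) = k" for x w k by (simp add: spacers_def)
  have s: "HH v n + sa v n = pp v n" "HH v n + sb v n = ll v n" "HH v n + sc v n = qq v n"
    using heights[of n] by (auto simp: sa_def sb_def sc_def)
  note a = assms(1)[folded length_col]
  have app: "(A @ B) ! (length A + k) = B ! k" for A B :: "real list" and k by simp
  define w where "w = wid (Suc n)"
  define C where "C = col v n"
  obtain S0 S1 S2 S3 where eq: "col v (Suc n) =
      (C @ S0) @ (map (\<lambda>x. x + w) C @ S1) @ (map (\<lambda>x. x + 2 * w) C @ S2) @ map (\<lambda>x. x + 3 * w) C @ S3"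
    and S: "length S0 = sa v n" "length S1 = sb v n" "length S2 = sc v n"
    by (simp add: Let_def sp w_def C_def)
  have len: "length (C @ S0) = pp v n" "length (map (\<lambda>x. x + w) C @ S1) = ll v n"
    "length (map (\<lambda>x. x + 2 * w) C @ S2) = qq v n"
    using s S by (simp_all add: C_def length_col)
  have j: "j < length C" using a by (simp add: C_def)
  consider "i = 0" | "i = 1" | "i = 2" | "i = 3" using assms(2) by linarith
  then show ?thesis
  proof cases
    case 1
    then show ?thesis using j unfolding eq by (simp add: offset_def nth_append C_def)
  next
    case 2
    have "j + offset v n i = length (C @ S0) + j" using 2 len by (simp add: offset_def)
    then show ?thesis unfolding eq app using j 2 by (simp add: nth_append C_def w_def)
  next
    case 3
    have "j + offset v n i = length (C @ S0) + (length (map (\<lambda>x. x + w) C @ S1) + j)"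
      using 3 len by (simp add: offset_def)
    then show ?thesis unfolding eq app using j 3 by (simp add: nth_append C_def w_def)
  next
    case 4
    have "j + offset v n i = length (C @ S0) + (length (map (\<lambda>x. x + w) C @ S1)
        + (length (map (\<lambda>x. x + 2 * w) C @ S2) + j))"
      using 4 len by (simp add: offset_def)
    then show ?thesis unfolding eq app using j 4 by (simp add: nth_append C_def w_def)
  qed
qed

text \<open>The levels tile \<open>[0, H_n wid n)\<close>, which yields their disjointness. In the
  induction the four copies provide all residues modulo 4 below \<open>4 * H\<close>, and the
  spacers continue consecutively from there.\<close>

lemma set_col: "set (col v n) = (\<lambda>k. real k * wid n) ` {..<HH v n}"
proof (induction n)
  case 0
  then show ?case by (simp add: lessThan_Suc)
next
  case (Suc n)
  define w where "w = wid (Suc n)"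
  define H where "H = HH v n"
  define f where "f = (\<lambda>k. real k * w)"
  have C: "set (col v n) = f ` (\<lambda>k. 4 * k) ` {..<H}"
    unfolding Suc.IH image_image f_def w_def H_def using wid_Suc[of n] by (intro image_cong) auto
  have sp: "set (spacers (real m * w) w k) = f ` {m..<m + k}" for m k
  proof -
    have "{m..<m + k} = (\<lambda>i. m + i) ` {0..<k}" by (simp add: image_add_atLeastLessThan add.commute)
    then show ?thesis
      by (simp only: image_image spacers_def set_map set_upt f_def of_nat_add distrib_right)
  qed
  have fr: "fresh v n = real (4 * H) * w"
    using fresh_eq[of n] wid_Suc[of n] by (simp add: w_def H_def)
  have sh: "(\<lambda>x. x + c * w) ` f ` B = f ` (\<lambda>k. k + m) ` B" if "c = real m" for c m B
    using that unfolding image_image f_def by (intro image_cong) (auto simp: algebra_simps)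
  have shifts: "(\<lambda>x. x + w) ` f ` B = f ` (\<lambda>k. k + 1) ` B"
    "(\<lambda>x. x + 2 * w) ` f ` B = f ` (\<lambda>k. k + 2) ` B"
    "(\<lambda>x. x + 3 * w) ` f ` B = f ` (\<lambda>k. k + 3) ` B" for B
    using sh[of 1 1 B] sh[of 2 2 B] sh[of 3 3 B] by simp_all
  define s0 where "s0 = spacers (real (4 * H) * w) w (sa v n)"
  define s1 where "s1 = spacers (real (4 * H + sa v n) * w) w (sb v n)"
  define s2 where "s2 = spacers (real (4 * H + sa v n + sb v n) * w) w (sc v n)"
  define s3 where "s3 = spacers (real (4 * H + sa v n + sb v n + sc v n) * w) w (sd v n)"
  have "col v (Suc n) = col v n @ s0 @ map (\<lambda>x. x + w) (col v n) @ s1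
     @ map (\<lambda>x. x + 2 * w) (col v n) @ s2 @ map (\<lambda>x. x + 3 * w) (col v n) @ s3"
    by (simp add: Let_def fr w_def[symmetric] s0_def s1_def s2_def s3_def algebra_simps)
  then have "set (col v (Suc n)) = f ` ((\<lambda>k. 4 * k) ` {..<H} \<union> (\<lambda>k. k + 1) ` (\<lambda>k. 4 * k) ` {..<H}
     \<union> (\<lambda>k. k + 2) ` (\<lambda>k. 4 * k) ` {..<H} \<union> (\<lambda>k. k + 3) ` (\<lambda>k. 4 * k) ` {..<H}
     \<union> {4*H..<4*H+sa v n} \<union> {4*H+sa v n..<4*H+sa v n + sb v n}
     \<union> {4*H+sa v n+sb v n..<4*H+sa v n + sb v n+sc v n}
     \<union> {4*H+sa v n+sb v n+sc v n..<4*H+sa v n + sb v n+sc v n+sd v n})"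
    by (simp only: set_append set_map s0_def s1_def s2_def s3_def sp C shifts image_Un Un_ac)
  also have "\<dots> = f ` {..<HH v (Suc n)}"
  proof -
    have tot: "4*H+sa v n + sb v n+sc v n+sd v n = HH v (Suc n)"
      using heights[of n] by (simp add: sa_def sb_def sc_def sd_def H_def)
    have low: "(\<lambda>k. 4 * k) ` {..<H} \<union> (\<lambda>k. k + 1) ` (\<lambda>k. 4 * k) ` {..<H}
     \<union> (\<lambda>k. k + 2) ` (\<lambda>k. 4 * k) ` {..<H} \<union> (\<lambda>k. k + 3) ` (\<lambda>k. 4 * k) ` {..<H} = {..<4*H}" (is "?L = _")
    proof (intro set_eqI iffI)
      fix m :: nat assume m: "m \<in> {..<4*H}"
      have "m = 4 * (m div 4) + m mod 4" "m mod 4 < 4" "m div 4 < H" using m by auto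
      then consider "m = 4 * (m div 4)" | "m = 4 * (m div 4) + 1" | "m = 4 * (m div 4) + 2"
        | "m = 4 * (m div 4) + 3" by linarith
      then show "m \<in> ?L" using \<open>m div 4 < H\<close> unfolding image_image by cases blast+
    qed auto
    show ?thesis unfolding low by (rule arg_cong[where f="(`) f"]) (use tot in auto)
  qed
  finally show ?case by (simp add: f_def w_def)
qed

lemma distinct_col: "distinct (col v n)"
proof (rule card_distinct)
  have "inj_on (\<lambda>k. real k * wid n) {..<HH v n}"
    using wid_pos[of n] by (auto simp: inj_on_def)
  then show "card (set (col v n)) = length (col v n)"
    unfolding set_col length_col by (simp add: card_image)
qed

lemma level_unique:
  assumes "x \<in> level v n i" "x \<in> level v n j" "i < HH v n" "j < HH v n"
  shows "i = j"
proof -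
  have "col v n ! i \<in> set (col v n)" "col v n ! j \<in> set (col v n)"
    using assms by (auto simp: length_col)
  then obtain a b :: nat where ab: "col v n ! i = real a * wid n" "col v n ! j = real b * wid n"
    unfolding set_col by auto
  have "real a * wid n < (real b + 1) * wid n" "real b * wid n < (real a + 1) * wid n"
    using assms(1,2) by (auto simp: level_def ab algebra_simps)
  then have "a = b" using wid_pos[of n] by (simp add: mult_less_cancel_right)
  then show ?thesis using nth_eq_iff_index_eq[OF distinct_col, of i n j] ab assms(3,4) by (simp add: length_col)
qed

section \<open>Height of a point through the stages\<close>

definition tower :: "nat \<Rightarrow> real set" where
  "tower n = (\<Union>j<HH v n. level v n j)"

lemma Xsp_eq: "Xsp v = (\<Union>n. tower n)"
  by (simp add: Xsp_def tower_def length_col)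

text \<open>The height \<open>I_n x\<close> of the overview; it is meaningful only for
  \<open>x\<close> in \<open>tower n\<close>.\<close>

definition index :: "nat \<Rightarrow> real \<Rightarrow> nat" where
  "index n x = (THE j. j < HH v n \<and> x \<in> level v n j)"

lemma index_eqI: "x \<in> level v n j \<Longrightarrow> j < HH v n \<Longrightarrow> index n x = j"
  unfolding index_def by (rule the_equality) (auto intro: level_unique)

lemma towerI: "x \<in> level v n j \<Longrightarrow> j < HH v n \<Longrightarrow> x \<in> tower n"
  by (auto simp: tower_def)

lemma index_level: "x \<in> tower n \<Longrightarrow> x \<in> level v n (index n x)"
  and index_less: "x \<in> tower n \<Longrightarrow> index n x < HH v n"
  by (auto simp: tower_def index_eqI)

lemma offset_less: "offset v n i + HH v n < HH v (Suc n)"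
  using heights[of n] by (auto simp: offset_def)

lemma level_Suc:
  assumes "j < HH v n" "i < 4"
  shows "level v (Suc n) (j + offset v n i) =
    {col v n ! j + real i * wid (Suc n) ..< col v n ! j + real (Suc i) * wid (Suc n)}"
  unfolding level_def col_Suc_nth[OF assms] by (auto simp: algebra_simps)

lemma level_Suc_subset:
  assumes "j < HH v n" "i < 4"
  shows "level v (Suc n) (j + offset v n i) \<subseteq> level v n j"
proof -
  have "0 \<le> real i * wid (Suc n)" "real (Suc i) * wid (Suc n) \<le> 4 * wid (Suc n)"
    using wid_pos[of "Suc n"] assms(2) by (auto intro!: mult_right_mono)
  then show ?thesis
    unfolding level_Suc[OF assms] by (auto simp: level_def wid_Suc[of n])
qed

lemma level_split:
  assumes "x \<in> level v n j" "j < HH v n"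
  obtains i where "i < 4" "x \<in> level v (Suc n) (j + offset v n i)"
proof -
  define w c where "w = wid (Suc n)" and "c = col v n ! j"
  have w: "0 < w" "c \<le> x" "x < c + 4 * w"
    using assms(1) wid_pos wid_Suc[of n] by (auto simp: level_def w_def c_def)
  consider "x < c + w" | "c + w \<le> x" "x < c + 2 * w" | "c + 2 * w \<le> x" "x < c + 3 * w"
    | "c + 3 * w \<le> x" by linarith
  then have "\<exists>i<4. c + real i * w \<le> x \<and> x < c + real (Suc i) * w"
  proof cases
    case 1 then show ?thesis using w by (intro exI[of _ 0]) auto
  next
    case 2 then show ?thesis using w by (intro exI[of _ 1]) auto
  next
    case 3 then show ?thesis using w by (intro exI[of _ 2]) auto
  next
    case 4 then show ?thesis using w by (intro exI[of _ 3]) auto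
  qed
  then obtain i where i: "i < 4" "c + real i * w \<le> x" "x < c + real (Suc i) * w" by blast
  show ?thesis
    by (rule that[OF i(1)], subst level_Suc[OF assms(2) i(1)]) (use i in \<open>simp add: c_def w_def\<close>)
qed

lemma index_Suc:
  assumes "x \<in> tower n"
  obtains i where "i < 4" "index (Suc n) x = index n x + offset v n i" "x \<in> tower (Suc n)"
proof -
  note x = index_level[OF assms] index_less[OF assms]
  obtain i where i: "i < 4" "x \<in> level v (Suc n) (index n x + offset v n i)"
    using level_split[OF x] .
  have "index n x + offset v n i < HH v (Suc n)" using x(2) offset_less[of n i] by linarith
  with i(2) show ?thesis by (intro that[OF i(1)] index_eqI towerI)
qed

lemma tower_mono: "m \<le> n \<Longrightarrow> tower m \<subseteq> tower n"
  by (rule lift_Suc_mono_le) (auto elim: index_Suc)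

text \<open>The last subcolumn also receives spacers, so no point of \<open>G_n\<close> lies in the
  top level of \<open>G_(n+1)\<close>. Hence every point of \<open>Xsp v\<close> is moved up a level
  at some stage.\<close>

lemma index_Suc_not_top:
  assumes "x \<in> tower n"
  shows "Suc (index (Suc n) x) < HH v (Suc n)"
proof -
  obtain i where "index (Suc n) x = index n x + offset v n i"
    using index_Suc[OF assms] by metis
  then show ?thesis using index_less[OF assms] offset_less[of n i] by linarith
qed

lemma step_Suc:
  assumes "x \<in> tower n" "Suc (index n x) < HH v n"
  shows "Suc (index (Suc n) x) < HH v (Suc n)"
    and "col v (Suc n) ! Suc (index (Suc n) x) - col v (Suc n) ! index (Suc n) x
       = col v n ! Suc (index n x) - col v n ! index n x"
proof -
  obtain i where i: "i < 4" "index (Suc n) x = index n x + offset v n i"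
    using index_Suc[OF assms(1)] by metis
  show "Suc (index (Suc n) x) < HH v (Suc n)" by (rule index_Suc_not_top[OF assms(1)])
  show "col v (Suc n) ! Suc (index (Suc n) x) - col v (Suc n) ! index (Suc n) x
       = col v n ! Suc (index n x) - col v n ! index n x"
    using col_Suc_nth[OF assms(2) i(1)] col_Suc_nth[OF index_less[OF assms(1)] i(1)] i(2)
    by simp
qed

text \<open>The translation to the next level does not change from one stage to the next, which
  makes the choice in \<open>Tv\<close> harmless.\<close>

lemma step_mono:
  assumes "x \<in> tower m" "Suc (index m x) < HH v m" "m \<le> n"
  shows "Suc (index n x) < HH v n \<and>
    col v n ! Suc (index n x) - col v n ! index n x
       = col v m ! Suc (index m x) - col v m ! index m x"
  using assms(3)
proof (induction n rule: dec_induct)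
  case (step n)
  have "x \<in> tower n" using tower_mono step(1) assms(1) by blast
  then show ?case using step_Suc[of x n] step.IH by simp
qed (use assms in auto)

section \<open>The transformation on levels\<close>

text \<open>The pair picked by \<open>SOME\<close> and the given pair are both addresses of
  \<open>x\<close>; \<open>step_mono\<close>, applied from the earlier stage to the later one, shows
  that they prescribe the same translation.\<close>

lemma Tv_level:
  assumes "x \<in> level v n j" "Suc j < HH v n"
  shows "Tv v x = x + (col v n ! Suc j - col v n ! j)"
proof -
  have ex: "\<exists>n j. Suc j < length (col v n) \<and> x \<in> level v n j"
    using assms by (auto simp: length_col)
  define P where "P = (\<lambda>(n, j). Suc j < length (col v n) \<and> x \<in> level v n j)"
  have "P (n, j)" using assms by (simp add: P_def length_col)
  then have "P (SOME z. P z)" by (rule someI)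
  moreover obtain m k where mk: "(SOME z. P z) = (m, k)" by fastforce
  ultimately have k: "Suc k < HH v m" "x \<in> level v m k" by (auto simp: P_def length_col)
  have idx: "index n x = j" "index m x = k" "x \<in> tower n" "x \<in> tower m"
    using assms k by (auto intro: index_eqI towerI)
  have "Tv v x = x + (col v m ! Suc k - col v m ! k)"
    unfolding Tv_def using ex mk by (simp add: P_def)
  also have "col v m ! Suc k - col v m ! k = col v n ! Suc j - col v n ! j"
    using step_mono[of x m n] step_mono[of x n m] idx k assms by (cases "m \<le> n") auto
  finally show ?thesis .
qed

lemma Tv_pow_level:
  assumes "x \<in> level v n j" "j + k < HH v n"
  shows "(Tv v ^^ k) x = x + (col v n ! (j + k) - col v n ! j)"
    and "(Tv v ^^ k) x \<in> level v n (j + k)"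
proof -
  have "(Tv v ^^ k) x = x + (col v n ! (j + k) - col v n ! j) \<and> (Tv v ^^ k) x \<in> level v n (j + k)"
    using assms(2)
  proof (induction k)
    case 0
    then show ?case using assms(1) by simp
  next
    case (Suc k)
    then have IH: "(Tv v ^^ k) x = x + (col v n ! (j + k) - col v n ! j)"
      "(Tv v ^^ k) x \<in> level v n (j + k)" by auto
    have "Tv v ((Tv v ^^ k) x) = (Tv v ^^ k) x + (col v n ! Suc (j + k) - col v n ! (j + k))"
      by (rule Tv_level[OF IH(2)]) (use Suc.prems in simp)
    then show ?case using IH by (simp add: level_def)
  qed
  then show "(Tv v ^^ k) x = x + (col v n ! (j + k) - col v n ! j)"
    and "(Tv v ^^ k) x \<in> level v n (j + k)" by auto
qed

lemma eventually_index_Tv: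
  assumes "x \<in> Xsp v"
  shows "Tv v x \<in> Xsp v"
    and "\<forall>\<^sub>F n in sequentially. x \<in> tower n \<and> Tv v x \<in> tower n \<and> index n (Tv v x) = Suc (index n x)"
proof -
  obtain m where m: "x \<in> tower m" using assms by (auto simp: Xsp_eq)
  have *: "x \<in> tower n \<and> Tv v x \<in> tower n \<and> index n (Tv v x) = Suc (index n x)" if "n \<ge> Suc m" for n
  proof -
    \<comment> \<open>As \<open>x\<close> belongs already to stage \<open>n - 1\<close>, it is not
      in the top level of \<open>G_n\<close>.\<close>
    have x: "x \<in> tower (n - 1)" "x \<in> tower n"
      using tower_mono[of m "n - 1"] tower_mono[of m n] m that by (auto simp: subset_iff le_diff_conv)
    have "Suc (index n x) < HH v n" using index_Suc_not_top[OF x(1)] that by simp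
    with Tv_pow_level(2)[OF index_level[OF x(2)], of 1] show ?thesis
      using x(2) by (auto intro: index_eqI towerI)
  qed
  then show "\<forall>\<^sub>F n in sequentially. x \<in> tower n \<and> Tv v x \<in> tower n \<and> index n (Tv v x) = Suc (index n x)"
    unfolding eventually_sequentially by blast
  show "Tv v x \<in> Xsp v" using *[of "Suc m"] by (auto simp: Xsp_eq)
qed

lemma eventually_index_Tv_pow:
  assumes "x \<in> Xsp v"
  shows "(Tv v ^^ k) x \<in> Xsp v \<and>
    (\<forall>\<^sub>F n in sequentially. x \<in> tower n \<and> (Tv v ^^ k) x \<in> tower n \<and> index n ((Tv v ^^ k) x) = index n x + k)"
proof (induction k)
  case 0
  then show ?case using assms eventually_index_Tv(2)[OF assms] by (auto elim: eventually_mono)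
next
  case (Suc k)
  then have "(Tv v ^^ k) x \<in> Xsp v" by blast
  note T = eventually_index_Tv[OF this]
  from Suc have "\<forall>\<^sub>F n in sequentially. x \<in> tower n \<and> (Tv v ^^ k) x \<in> tower n \<and> index n ((Tv v ^^ k) x) = index n x + k"
    by blast
  with T(2) have "\<forall>\<^sub>F n in sequentially. x \<in> tower n \<and> (Tv v ^^ Suc k) x \<in> tower n \<and>
      index n ((Tv v ^^ Suc k) x) = index n x + Suc k"
    by eventually_elim auto
  with T(1) show ?case by simp
qed

end

section \<open>Product measure\<close>

lemma sigma_finite_restrict_space:
  assumes "sigma_finite_measure M" "\<Omega> \<in> sets M"
  shows "sigma_finite_measure (restrict_space M \<Omega>)"
proof -
  interpret sigma_finite_measure M by fact
  obtain F where F: "countable F" "F \<subseteq> sets M" "\<Union>F = space M" "\<forall>a\<in>F. emeasure M a \<noteq> \<infinity>"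
    using sigma_finite_countable by blast
  have \<Omega>: "\<Omega> \<inter> space M \<in> sets M" "\<Omega> \<subseteq> space M"
    using assms(2) sets.sets_into_space by auto
  show ?thesis
  proof (standard, intro exI[of _ "(\<lambda>a. a \<inter> \<Omega>) ` F"] conjI)
    show "(\<lambda>a. a \<inter> \<Omega>) ` F \<subseteq> sets (restrict_space M \<Omega>)"
      using F(2) assms(2) by (auto simp: sets_restrict_space_iff[OF \<Omega>(1)])
    show "\<Union> ((\<lambda>a. a \<inter> \<Omega>) ` F) = space (restrict_space M \<Omega>)"
      using F(3) \<Omega>(2) by (auto simp: space_restrict_space)
    show "\<forall>a\<in>(\<lambda>a. a \<inter> \<Omega>) ` F. emeasure (restrict_space M \<Omega>) a \<noteq> \<infinity>"
    proof safe
      fix a assume a: "a \<in> F" "emeasure (restrict_space M \<Omega>) (a \<inter> \<Omega>) = \<infinity>"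
      have "emeasure M (a \<inter> \<Omega>) \<le> emeasure M a"
        using a F(2) by (intro emeasure_mono) auto
      then show False
        using a F(4) by (auto simp: emeasure_restrict_space[OF \<Omega>(1)] top_unique)
    qed
  qed (use F(1) in auto)
qed

lemma pair_restrict_space:
  assumes "sigma_finite_measure N" "\<Omega> \<in> sets M" "\<Xi> \<in> sets N"
    and A: "A \<in> sets (restrict_space M \<Omega> \<Otimes>\<^sub>M restrict_space N \<Xi>)"
  shows "A \<in> sets (M \<Otimes>\<^sub>M N)"
    and "emeasure (restrict_space M \<Omega> \<Otimes>\<^sub>M restrict_space N \<Xi>) A = emeasure (M \<Otimes>\<^sub>M N) A"
proof -
  have sub: "\<Omega> \<inter> space M \<in> sets M" "\<Xi> \<inter> space N \<in> sets N"
    using assms(2,3) by auto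
  have box: "(\<Omega> \<times> \<Xi>) \<inter> space (M \<Otimes>\<^sub>M N) \<in> sets (M \<Otimes>\<^sub>M N)"
    using assms(2,3) by auto
  have AS: "A \<subseteq> \<Omega> \<times> \<Xi>"
    using sets.sets_into_space[OF A] by (auto simp: space_pair_measure space_restrict_space)
  have meas: "(\<lambda>z. (fst z, snd z)) \<in> measurable (restrict_space (M \<Otimes>\<^sub>M N) (\<Omega> \<times> \<Xi>))
      (restrict_space M \<Omega> \<Otimes>\<^sub>M restrict_space N \<Xi>)"
    by (intro measurable_Pair measurable_restrict_space2 measurable_restrict_space1)
       (auto simp: space_restrict_space)
  have "A \<in> sets (restrict_space (M \<Otimes>\<^sub>M N) (\<Omega> \<times> \<Xi>))"
  proof -
    have "(\<lambda>z. (fst z, snd z)) -` A \<inter> space (restrict_space (M \<Otimes>\<^sub>M N) (\<Omega> \<times> \<Xi>)) = A"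
      using AS sets.sets_into_space[OF A]
      by (auto simp: space_restrict_space space_pair_measure)
    then show ?thesis using measurable_sets[OF meas A] by simp
  qed
  then show A2: "A \<in> sets (M \<Otimes>\<^sub>M N)"
    by (simp add: sets_restrict_space_iff[OF box])
  interpret N: sigma_finite_measure N by fact
  interpret R: sigma_finite_measure "restrict_space N \<Xi>"
    by (rule sigma_finite_restrict_space) fact+
  have "emeasure (restrict_space M \<Omega> \<Otimes>\<^sub>M restrict_space N \<Xi>) A
      = (\<integral>\<^sup>+x. (\<integral>\<^sup>+y. indicator A (x, y) * indicator \<Xi> y \<partial>N) * indicator \<Omega> x \<partial>M)"
    unfolding R.emeasure_pair_measure[OF A] nn_integral_restrict_space[OF sub(1)]
      nn_integral_restrict_space[OF sub(2)] ..
  also have "\<dots> = (\<integral>\<^sup>+x. \<integral>\<^sup>+y. indicator A (x, y) \<partial>N \<partial>M)"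
  proof (intro nn_integral_cong)
    fix x
    have "indicator A (x, y) * indicator \<Xi> y = (indicator A (x, y) :: ennreal)" for y
      using AS by (auto simp: indicator_def)
    moreover have "(indicator A (x, y) :: ennreal) = 0" if "x \<notin> \<Omega>" for y
      using AS that by (auto simp: indicator_def)
    ultimately show "(\<integral>\<^sup>+y. indicator A (x, y) * indicator \<Xi> y \<partial>N) * indicator \<Omega> x
        = (\<integral>\<^sup>+y. indicator A (x, y) \<partial>N)"
      by (cases "x \<in> \<Omega>") auto
  qed
  also have "\<dots> = emeasure (M \<Otimes>\<^sub>M N) A"
    by (rule N.emeasure_pair_measure[OF A2, symmetric])
  finally show "emeasure (restrict_space M \<Omega> \<Otimes>\<^sub>M restrict_space N \<Xi>) A = emeasure (M \<Otimes>\<^sub>M N) A" .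
qed

lemma emeasure_lborel_translate:
  fixes c :: "'a::euclidean_space"
  assumes "A \<in> sets borel"
  shows "emeasure lborel ((\<lambda>z. z + c) -` A) = emeasure lborel A"
proof -
  have "emeasure lborel A = emeasure (distr lborel borel ((+) c)) A"
    by (simp add: lborel_distr_plus)
  also have "\<dots> = emeasure lborel ((+) c -` A)"
    using assms by (subst emeasure_distr) auto
  finally show ?thesis by (simp add: vimage_def add.commute)
qed

section \<open>Lebesgue measure on \<open>Xsp v\<close> and its square\<close>

context rank_one
begin

lemma level_borel [measurable]: "level v n j \<in> sets borel"
  by (simp add: level_def)

lemma tower_borel [measurable]: "tower n \<in> sets borel"
  by (auto simp: tower_def)

lemma Xsp_borel [measurable]: "Xsp v \<in> sets borel"
  by (auto simp: Xsp_eq)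

lemma space_muX: "space (muX v) = Xsp v"
  by (simp add: muX_def space_restrict_space)

lemma sets_muX: "A \<in> sets (muX v) \<longleftrightarrow> A \<subseteq> Xsp v \<and> A \<in> sets borel"
  by (simp add: muX_def sets_restrict_space_iff)

lemma tower_subset: "tower n \<subseteq> Xsp v"
  by (auto simp: Xsp_eq)

lemma level_subset: "j < HH v n \<Longrightarrow> level v n j \<subseteq> tower n"
  by (auto simp: tower_def)

text \<open>This moves all measure computations to planar Lebesgue measure, where outer regularity
  and translation invariance are available.\<close>

lemma prod_sets:
  assumes "A \<in> sets (muX v \<Otimes>\<^sub>M muX v)"
  shows "A \<in> sets borel" "A \<subseteq> Xsp v \<times> Xsp v"
    "emeasure (muX v \<Otimes>\<^sub>M muX v) A = emeasure lborel A"
proof -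
  have X: "Xsp v \<in> sets lborel" by simp
  show "A \<in> sets borel" "emeasure (muX v \<Otimes>\<^sub>M muX v) A = emeasure lborel A"
    using pair_restrict_space[OF sigma_finite_lborel X X assms[unfolded muX_def]]
    unfolding muX_def lborel_prod by simp_all
  show "A \<subseteq> Xsp v \<times> Xsp v"
    using sets.sets_into_space[OF assms] by (simp add: space_pair_measure space_muX)
qed

lemma cell_sets:
  "i < HH v n \<Longrightarrow> j < HH v n \<Longrightarrow> level v n i \<times> level v n j \<in> sets (muX v \<Otimes>\<^sub>M muX v)"
  using order_trans[OF level_subset tower_subset] by (intro pair_measureI) (auto simp: sets_muX)

lemma cell_emeasure: "emeasure lborel (level v n i \<times> level v n j) = ennreal (wid n ^ 2)"
proof -
  have "emeasure lborel (level v n i \<times> level v n j) = emeasure lborel (level v n i) * emeasure lborel (level v n j)"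
    unfolding lborel_prod[symmetric] by (intro lborel.emeasure_pair_measure_Times) simp_all
  then show ?thesis
    using wid_pos[of n] by (simp add: level_def power2_eq_square ennreal_mult)
qed

lemma measurable_Tv: "Tv v \<in> measurable (muX v) (muX v)"
proof (rule measurableI)
  fix x assume "x \<in> space (muX v)"
  then show "Tv v x \<in> space (muX v)" using eventually_index_Tv(1) by (simp add: space_muX)
next
  fix B assume "B \<in> sets (muX v)"
  then have B: "B \<subseteq> Xsp v" "B \<in> sets borel" by (auto simp: sets_muX)
  \<comment> \<open>On a single level \<open>Tv v\<close> is a translation, so the preimage is a
    countable union of Borel pieces.\<close>
  define W where "W n j = level v n j \<inter> (\<lambda>x. x + (col v n ! Suc j - col v n ! j)) -` B" for n j
  have "Tv v -` B \<inter> Xsp v = (\<Union>n. \<Union>j\<in>{j. Suc j < HH v n}. W n j)"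
  proof (intro set_eqI iffI)
    fix x assume x: "x \<in> Tv v -` B \<inter> Xsp v"
    then obtain n where n: "x \<in> tower n" by (auto simp: Xsp_eq)
    then have c: "x \<in> tower (Suc n)" using tower_mono[of n "Suc n"] by auto
    note t = index_Suc_not_top[OF n] index_level[OF c]
    have "x \<in> W (Suc n) (index (Suc n) x)"
      using Tv_level[OF t(2,1)] x t(2) by (simp add: W_def)
    then show "x \<in> (\<Union>n. \<Union>j\<in>{j. Suc j < HH v n}. W n j)" using t(1) by blast
  next
    fix x assume "x \<in> (\<Union>n. \<Union>j\<in>{j. Suc j < HH v n}. W n j)"
    then obtain n j where j: "Suc j < HH v n" "x \<in> W n j" by blast
    then have "x \<in> level v n j" by (simp add: W_def)
    moreover have "level v n j \<subseteq> Xsp v"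
      using level_subset[of j n] tower_subset[of n] j(1) by auto
    ultimately show "x \<in> Tv v -` B \<inter> Xsp v"
      using Tv_level[of x n j] j by (auto simp: W_def)
  qed
  moreover have "W n j \<in> sets borel" for n j
  proof -
    have "(\<lambda>x::real. x + (col v n ! Suc j - col v n ! j)) \<in> borel_measurable borel" by measurable
    from measurable_sets[OF this B(2)] show ?thesis by (auto simp: W_def)
  qed
  then have "(\<Union>n. \<Union>j\<in>{j. Suc j < HH v n}. W n j) \<in> sets borel"
    by (intro sets.countable_UN'' sets.countable_UN) auto
  ultimately show "Tv v -` B \<inter> space (muX v) \<in> sets (muX v)"
    by (auto simp: sets_muX space_muX)
qed

abbreviation prodpow :: "nat \<Rightarrow> nat \<Rightarrow> real \<times> real \<Rightarrow> real \<times> real" where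
  "prodpow p q \<equiv> \<lambda>(x, y). ((Tv v ^^ p) x, (Tv v ^^ q) y)"

lemma measurable_prodpow:
  "prodpow p q \<in> measurable (muX v \<Otimes>\<^sub>M muX v) (muX v \<Otimes>\<^sub>M muX v)"
  unfolding split_beta'
  by (intro measurable_Pair measurable_compose[OF measurable_fst] measurable_compose[OF measurable_snd]
      measurable_compose_n measurable_Tv)

lemma prodpow_funpow: "prodpow p q ^^ s = prodpow (p * s) (q * s)"
proof
  fix z :: "real \<times> real"
  obtain x y where z: "z = (x, y)" by fastforce
  have "(prodpow p q ^^ s) (x, y) = (((Tv v ^^ p) ^^ s) x, ((Tv v ^^ q) ^^ s) y)"
    by (induction s) auto
  then show "(prodpow p q ^^ s) z = prodpow (p * s) (q * s) z"
    by (simp add: z funpow_mult)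
qed

lemma level_refine:
  assumes "x \<in> tower m" "m \<le> n"
  shows "level v n (index n x) \<subseteq> level v m (index m x)"
  using assms(2)
proof (induction n rule: dec_induct)
  case (step n)
  have x: "x \<in> tower n" using tower_mono[OF step(1)] assms(1) by blast
  obtain i where i: "i < 4" "index (Suc n) x = index n x + offset v n i"
    using index_Suc[OF x] by metis
  show ?case
    using level_Suc_subset[OF index_less[OF x] i(1)] step.IH i(2) by auto
qed simp

section \<open>Conservativity\<close>

text \<open>A density theorem for cells whose stage lies in a prescribed infinite set. Otherwise
  every such cell misses \<open>A\<close> in at least a fraction \<epsilon>; covering
  \<open>A\<close> by disjoint cells inside an open \<open>U\<close> would then make
  \<open>U - A\<close> at least \<epsilon> times as large as \<open>A\<close>, against outer
  regularity.\<close>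

lemma density_cell:
  fixes A :: "(real \<times> real) set"
  assumes A: "A \<in> sets borel" "A \<subseteq> tower N \<times> tower N" "0 < emeasure lborel A"
    and Z: "infinite Z" and \<epsilon>: "0 < (\<epsilon>::real)"
  obtains n i j where "n \<in> Z" "i < HH v n" "j < HH v n"
    "emeasure lborel (level v n i \<times> level v n j - A) < ennreal \<epsilon> * emeasure lborel (level v n i \<times> level v n j)"
proof (rule ccontr)
  note cell_found = that
  assume no: "\<not> thesis"
  define cell where "cell = (\<lambda>(n, i, j). level v n i \<times> level v n j)"
  have cell_borel: "cell c \<in> sets borel" for c
    by (cases c) (simp add: cell_def borel_Times)
  have neg: "ennreal \<epsilon> * emeasure lborel (level v n i \<times> level v n j) \<le> emeasure lborel (level v n i \<times> level v n j - A)"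
    if "n \<in> Z" "i < HH v n" "j < HH v n" for n i j
    using no cell_found[OF that] by (metis not_le)
  have "bounded (level v N j)" for j
    by (rule bounded_subset[of "{col v N ! j..col v N ! j + wid N}"]) (auto simp: level_def)
  then have "bounded (tower N \<times> tower N)"
    by (auto simp: tower_def intro!: bounded_Times)
  then have "bounded A" using A(2) bounded_subset by blast
  then have fin: "emeasure lborel A < \<infinity>" by (rule emeasure_bounded_finite)
  define e where "e = \<epsilon> * measure lborel A"
  have e: "ennreal e = ennreal \<epsilon> * emeasure lborel A"
    using fin \<epsilon> by (simp add: e_def ennreal_mult emeasure_eq_ennreal_measure less_top)
  have "0 < e"
    using A(3) fin \<epsilon> by (simp add: e_def emeasure_eq_ennreal_measure less_top)
  then obtain U where U: "open U" "A \<subseteq> U" "emeasure lborel (U - A) < e"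
    using outer_regular_lborel[OF A(1)] by blast
  \<comment> \<open>Cells are named by triples, so \<open>K\<close> below is countable and each
    selected cell is counted once. Every point of \<open>A\<close> selects its cell at the first
    stage in \<open>Z\<close>, from \<open>N\<close> on, at which that cell fits into
    \<open>U\<close>.\<close>
  define adr where "adr n z = (n, index n (fst z), index n (snd z))" for n and z :: "real \<times> real"
  define good where "good z n \<longleftrightarrow> n \<in> Z \<and> N \<le> n \<and> cell (adr n z) \<subseteq> U" for z n
  define \<nu> where "\<nu> z = (LEAST n. good z n)" for z
  have inA: "fst z \<in> tower n" "snd z \<in> tower n" if "z \<in> A" "N \<le> n" for z n
    using subsetD[OF A(2) that(1)] tower_mono[OF that(2)] by (auto simp: mem_Times_iff)
  have self: "z \<in> cell (adr n z)" if "z \<in> A" "N \<le> n" for z n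
    using inA[OF that] index_level by (auto simp: cell_def adr_def mem_Times_iff)
  have "\<exists>n. good z n" if z: "z \<in> A" for z
  proof -
    obtain d where d: "0 < d" "ball z d \<subseteq> U"
      using U(1,2) z open_contains_ball by blast
    obtain k where k: "(1/4::real) ^ k < d / 2"
      using real_arch_pow_inv[of "d / 2" "1/4"] d(1) by auto
    obtain n where n: "n \<in> Z" "max k N \<le> n"
      using Z by (meson infinite_nat_iff_unbounded_le)
    have "wid n = (1/4) ^ n" by (simp add: wid_def power_one_over)
    also have "\<dots> \<le> (1/4) ^ k" using n(2) by (intro power_decreasing) auto
    finally have w: "2 * wid n < d" using k by simp
    have "cell (adr n z) \<subseteq> ball z d"
    proof
      fix z' assume z': "z' \<in> cell (adr n z)"
      have "z \<in> cell (adr n z)" using self[OF z] n(2) by simp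
      then have "dist (fst z) (fst z') < wid n" "dist (snd z) (snd z') < wid n"
        using z' by (auto simp: cell_def adr_def level_def dist_real_def mem_Times_iff)
      moreover have "dist z z' \<le> dist (fst z) (fst z') + dist (snd z) (snd z')"
        by (simp add: dist_prod_def sqrt_sum_squares_le_sum)
      ultimately show "z' \<in> ball z d" using w by simp
    qed
    then show ?thesis using n d(2) by (auto simp: good_def)
  qed
  then have \<nu>: "good z (\<nu> z)" if "z \<in> A" for z
    using that unfolding \<nu>_def by (meson LeastI_ex)
  have \<nu>_le: "\<nu> z \<le> n" if "good z n" for z n
    using that unfolding \<nu>_def by (rule Least_le)
  define K where "K = (\<lambda>z. adr (\<nu> z) z) ` A"
  \<comment> \<open>Cells are nested or disjoint. If two selected cells meet, the one of the earlier
    stage also contains the other point, which must therefore have selected it too.\<close>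
  have overlap: "adr (\<nu> z) z = adr (\<nu> z') z'"
    if z: "z \<in> A" "z' \<in> A" "\<nu> z \<le> \<nu> z'" and w: "w \<in> cell (adr (\<nu> z) z)" "w \<in> cell (adr (\<nu> z') z')" for z z' w
  proof -
    let ?n = "\<nu> z"
    have n: "N \<le> ?n" using \<nu>[OF z(1)] by (simp add: good_def)
    note c = inA[OF z(1) n] inA[OF z(2) n]
    have "fst w \<in> level v ?n (index ?n (fst z'))" "snd w \<in> level v ?n (index ?n (snd z'))"
      using level_refine[OF c(3) z(3)] level_refine[OF c(4) z(3)] w(2)
      by (auto simp: cell_def adr_def mem_Times_iff)
    moreover have "fst w \<in> level v ?n (index ?n (fst z))" "snd w \<in> level v ?n (index ?n (snd z))"
      using w(1) by (auto simp: cell_def adr_def mem_Times_iff)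
    ultimately have eq: "adr ?n z' = adr ?n z"
      using level_unique index_less c by (auto simp: adr_def)
    then have "good z' ?n" using \<nu>[OF z(1)] by (simp add: good_def)
    then have "\<nu> z' = ?n" using \<nu>_le z(3) by (simp add: le_antisym)
    then show ?thesis using eq by simp
  qed
  have "c = c'" if "c \<in> K" "c' \<in> K" "w \<in> cell c" "w \<in> cell c'" for c c' w
  proof -
    obtain z z' where zz: "z \<in> A" "c = adr (\<nu> z) z" "z' \<in> A" "c' = adr (\<nu> z') z'"
      using \<open>c \<in> K\<close> \<open>c' \<in> K\<close> by (auto simp: K_def)
    show ?thesis
      using overlap[of z z' w] overlap[of z' z w] zz that(3,4) by (cases "\<nu> z \<le> \<nu> z'") auto
  qed
  then have disj: "disjoint_family_on cell K"
    unfolding disjoint_family_on_def by blast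
  then have disj': "disjoint_family_on (\<lambda>c. cell c - A) K"
    unfolding disjoint_family_on_def by blast
  have "countable K" by (rule countable_subset[OF subset_UNIV]) simp
  define W where "W = (\<Union>c\<in>K. cell c)"
  have W: "A \<subseteq> W" "W \<subseteq> U"
    using self \<nu> by (fastforce simp: W_def K_def good_def)+
  have Wb: "W \<in> sets borel"
    unfolding W_def using \<open>countable K\<close> cell_borel by (intro sets.countable_UN'') auto
  have "ennreal e \<le> ennreal \<epsilon> * emeasure lborel W"
    unfolding e using W(1) Wb by (intro mult_left_mono emeasure_mono) auto
  also have "emeasure lborel W = (\<integral>\<^sup>+c. emeasure lborel (cell c) \<partial>count_space K)"
    unfolding W_def using \<open>countable K\<close> disj cell_borel by (intro emeasure_UN_countable) auto
  also have "ennreal \<epsilon> * \<dots> = (\<integral>\<^sup>+c. ennreal \<epsilon> * emeasure lborel (cell c) \<partial>count_space K)"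
    by (rule nn_integral_cmult[symmetric]) simp
  also have "\<dots> \<le> (\<integral>\<^sup>+c. emeasure lborel (cell c - A) \<partial>count_space K)"
  proof (rule nn_integral_mono)
    fix c assume "c \<in> space (count_space K)"
    then obtain z where z: "z \<in> A" "c = adr (\<nu> z) z" by (auto simp: K_def)
    then show "ennreal \<epsilon> * emeasure lborel (cell c) \<le> emeasure lborel (cell c - A)"
      using neg[of "\<nu> z"] \<nu>[OF z(1)] inA[OF z(1), of "\<nu> z"]
      by (auto simp: cell_def adr_def good_def intro: index_less)
  qed
  also have "\<dots> = emeasure lborel (\<Union>c\<in>K. cell c - A)"
    using \<open>countable K\<close> disj' cell_borel A(1) by (intro emeasure_UN_countable[symmetric]) auto
  also have "\<dots> \<le> emeasure lborel (U - A)"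
    using W(2) U(1) A(1) by (intro emeasure_mono) (auto simp: W_def)
  finally show False using U(3) by simp
qed

lemma conservative_proportional:
  assumes Z: "infinite Z" and s: "\<And>n. n \<in> Z \<Longrightarrow> pp v n = p * s n \<and> qq v n = q * s n"
  shows "conservative (muX v \<Otimes>\<^sub>M muX v) (prodpow p q)"
  unfolding conservative_def
proof (intro ballI impI)
  let ?M = "muX v \<Otimes>\<^sub>M muX v"
  fix A assume A: "A \<in> sets ?M" "0 < emeasure ?M A"
  note A' = prod_sets[OF A(1)]
  \<comment> \<open>The squares of the towers exhaust the space, so one of them meets
    \<open>A\<close> in positive measure.\<close>
  have "\<exists>N. 0 < emeasure lborel (A \<inter> tower N \<times> tower N)"
  proof (rule ccontr)
    assume "\<not> ?thesis"
    then have "A \<inter> tower N \<times> tower N \<in> null_sets lborel" for N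
      using A'(1) by (auto simp: null_sets_def not_less borel_Times)
    then have "(\<Union>N. A \<inter> tower N \<times> tower N) \<in> null_sets lborel" by blast
    moreover have "A = (\<Union>N. A \<inter> tower N \<times> tower N)"
    proof (intro equalityI subsetI)
      fix z assume z: "z \<in> A"
      then obtain a b where "fst z \<in> tower a" "snd z \<in> tower b"
        using subsetD[OF A'(2) z] by (auto simp: Xsp_eq mem_Times_iff)
      then have "z \<in> A \<inter> tower (max a b) \<times> tower (max a b)"
        using z tower_mono[of a "max a b"] tower_mono[of b "max a b"] by (auto simp: mem_Times_iff)
      then show "z \<in> (\<Union>N. A \<inter> tower N \<times> tower N)" by blast
    qed auto
    ultimately show False using A(2) A'(3) by (simp add: null_sets_def)
  qed
  then obtain N where N: "0 < emeasure lborel (A \<inter> tower N \<times> tower N)" by blast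
  have b: "A \<inter> tower N \<times> tower N \<in> sets borel" using A'(1) by (auto simp: borel_Times)
  \<comment> \<open>The cell has area \<open>16 * w ^ 2\<close>, with \<open>w\<close> the width at
    stage \<open>Suc n\<close>. Missing less than 1/32 of it means missing less than half the area
    of a subcell, so the losses in two subcells together cannot exhaust one.\<close>
  obtain n i j where n: "n \<in> Z" "i < HH v n" "j < HH v n" and
    dens: "emeasure lborel (level v n i \<times> level v n j - A \<inter> tower N \<times> tower N)
        < ennreal (1/32) * emeasure lborel (level v n i \<times> level v n j)"
    by (rule density_cell[OF b _ N Z, where \<epsilon>="1/32"]) auto
  define C where "C = level v n i \<times> level v n j"
  \<comment> \<open>Since \<open>p\<^sub>n = p s\<close> and \<open>q\<^sub>n = q s\<close>, the \<open>s\<close>-th iterate translates the part of \<open>C\<close> lying over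
    subcolumns (0, 2) onto the part over subcolumns (1, 3).\<close>
  define C1 where "C1 = level v (Suc n) (i + offset v n 0) \<times> level v (Suc n) (j + offset v n 2)"
  define C2 where "C2 = level v (Suc n) (i + offset v n 1) \<times> level v (Suc n) (j + offset v n 3)"
  define w where "w = wid (Suc n)"
  have sub: "C1 \<subseteq> C" "C2 \<subseteq> C"
    using level_Suc_subset[OF n(2)] level_Suc_subset[OF n(3)] unfolding C_def C1_def C2_def
    by (intro Sigma_mono; simp)+
  have borel: "C \<in> sets borel" "C1 \<in> sets borel" "C2 \<in> sets borel"
    by (auto simp: C_def C1_def C2_def borel_Times)
  have small: "emeasure lborel (C - A) < ennreal (w ^ 2 / 2)"
  proof -
    have "emeasure lborel (C - A) \<le> emeasure lborel (C - A \<inter> tower N \<times> tower N)"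
      using b borel by (intro emeasure_mono) auto
    also have "\<dots> < ennreal (1/32) * ennreal (wid n ^ 2)"
      using dens unfolding C_def cell_emeasure .
    also have "\<dots> = ennreal (w ^ 2 / 2)"
      by (simp add: ennreal_mult[symmetric] w_def wid_Suc[of n] power2_eq_square)
    finally show ?thesis .
  qed
  have shift: "C1 = (\<lambda>z. z + (w, w)) -` C2"
    unfolding C1_def C2_def level_Suc[OF n(2)] level_Suc[OF n(3)] w_def
    by (auto simp: level_Suc n algebra_simps)
  \<comment> \<open>The points of \<open>A\<close> in \<open>C1\<close> whose translate in
    \<open>C2\<close> is again in \<open>A\<close>.\<close>
  define B where "B = C1 \<inter> A \<inter> (\<lambda>z. z + (w, w)) -` A"
  have tr: "(\<lambda>z. z + (w, w)) -` X \<in> sets borel" if "X \<in> sets borel" for X :: "(real \<times> real) set"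
  proof -
    have "(\<lambda>z::real \<times> real. z + (w, w)) \<in> borel_measurable borel" by measurable
    from measurable_sets[OF this that] show ?thesis by simp
  qed
  have Bb: "B \<in> sets borel" unfolding B_def using borel A'(1) tr by auto
  have "0 < emeasure lborel B"
  proof (rule ccontr)
    assume "\<not> ?thesis"
    then have B0: "emeasure lborel B = 0" by simp
    have "ennreal (w ^ 2) = emeasure lborel C1" unfolding C1_def cell_emeasure w_def ..
    also have "\<dots> \<le> emeasure lborel (B \<union> ((C1 - A) \<union> (\<lambda>z. z + (w, w)) -` (C2 - A)))"
      using Bb borel A'(1) tr by (intro emeasure_mono) (auto simp: B_def shift)
    also have "\<dots> \<le> emeasure lborel B + (emeasure lborel (C1 - A) + emeasure lborel ((\<lambda>z. z + (w, w)) -` (C2 - A)))"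
      using Bb borel A'(1) tr
      by (intro order_trans[OF emeasure_subadditive] add_left_mono emeasure_subadditive) auto
    also have "\<dots> = emeasure lborel (C1 - A) + emeasure lborel (C2 - A)"
      using borel A'(1) by (simp add: B0 emeasure_lborel_translate)
    also have "\<dots> \<le> emeasure lborel (C - A) + emeasure lborel (C - A)"
      using sub borel A'(1) by (intro add_mono emeasure_mono) auto
    also have "\<dots> < ennreal (w ^ 2 / 2) + ennreal (w ^ 2 / 2)"
      using small by (intro add_strict_mono)
    also have "\<dots> = ennreal (w ^ 2)" by (simp add: ennreal_plus[symmetric] del: ennreal_plus)
    finally show False by simp
  qed
  have pq: "pp v n = p * s n" "qq v n = q * s n" using s[OF n(1)] by auto
  have "0 < pp v n" using heights(1)[of n] by linarith
  then have "1 \<le> s n" using pq by (cases "s n") auto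
  have B_sub: "B \<subseteq> (prodpow p q ^^ s n) -` A \<inter> A"
  proof
    fix z assume z: "z \<in> B"
    then obtain x y where xy: "z = (x, y)" "x \<in> level v (Suc n) (i + offset v n 0)"
      "y \<in> level v (Suc n) (j + offset v n 2)" "(x, y) \<in> A" "(x + w, y + w) \<in> A"
      by (cases z) (auto simp: B_def C1_def)
    have off: "i + offset v n 0 + p * s n = i + offset v n 1" "j + offset v n 2 + q * s n = j + offset v n 3"
      by (auto simp: offset_def pq)
    have lt: "i + offset v n 1 < HH v (Suc n)" "j + offset v n 3 < HH v (Suc n)"
      using n offset_less[of n 1] offset_less[of n 3] by linarith+
    have "(Tv v ^^ (p * s n)) x = x + w"
      using Tv_pow_level(1)[OF xy(2), of "p * s n"] lt(1) unfolding off
      by (simp only: col_Suc_nth[OF n(2)]) (simp add: col_Suc_nth[OF n(2)] w_def)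
    moreover have "(Tv v ^^ (q * s n)) y = y + w"
      using Tv_pow_level(1)[OF xy(3), of "q * s n"] lt(2) unfolding off
      by (simp add: col_Suc_nth[OF n(3)] w_def del: col.simps)
    ultimately show "z \<in> (prodpow p q ^^ s n) -` A \<inter> A"
      using xy by (simp add: prodpow_funpow)
  qed
  have "(prodpow p q ^^ s n) -` A \<inter> A \<in> sets ?M"
  proof -
    have "(prodpow p q ^^ s n) -` A \<inter> A = ((prodpow p q ^^ s n) -` A \<inter> space ?M) \<inter> A"
      using sets.sets_into_space[OF A(1)] by auto
    also have "\<dots> \<in> sets ?M"
      using A(1) by (intro sets.Int measurable_sets[OF measurable_compose_n[OF measurable_prodpow]])
    finally show ?thesis .
  qed
  note R = this prod_sets[OF this]
  have "emeasure lborel B \<le> emeasure lborel ((prodpow p q ^^ s n) -` A \<inter> A)"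
    using B_sub R(2) by (intro emeasure_mono) auto
  then have "0 < emeasure ?M ((prodpow p q ^^ s n) -` A \<inter> A)"
    using \<open>0 < emeasure lborel B\<close> R(4) by simp
  then show "\<exists>n\<ge>1. 0 < emeasure ?M ((prodpow p q ^^ n) -` A \<inter> A)"
    using \<open>1 \<le> s n\<close> by blast
qed

section \<open>Failure of ergodicity\<close>

text \<open>The invariant set consists of the points whose \<open>F n\<close> value is, for all
  large \<open>n\<close>, attained on the cell \<open>R0\<close>. It contains \<open>R0\<close>, and
  by descent to stage \<open>Suc M\<close> it misses \<open>R1\<close>.\<close>

lemma not_ergodic_gap:
  assumes pq: "0 < p" "p \<le> q"
    and big: "\<And>n. M \<le> n \<Longrightarrow> pp v n \<le> qq v n \<and> (p + q) * hh v n < pp v n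
        \<and> (p + q) * (pp v n + qq v n + 2 * hh v n) < ll v n"
    and gap: "\<And>n. M \<le> n \<Longrightarrow> int p * int (qq v n) = int q * int (pp v n)
        \<or> int ((p + q) * hh v n) < \<bar>int p * int (qq v n) - int q * int (pp v n)\<bar>"
  shows "\<not> ergodic (muX v \<Otimes>\<^sub>M muX v) (prodpow p q)"
proof
  let ?M = "muX v \<Otimes>\<^sub>M muX v"
  assume erg: "ergodic ?M (prodpow p q)"
  define F where "F n z = int q * int (index n (fst z)) - int p * int (index n (snd z))"
    for n and z :: "real \<times> real"
  \<comment> \<open>Points of \<open>G_n\<close> lie below the spacers on the last subcolumn, so
    their height in \<open>G_(n+1)\<close> is bounded by \<open>h_(n+1)\<close>, without the huge
    \<open>m_n\<close> that enters \<open>H_(n+1)\<close>.\<close>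
  have hh_bound: "index (Suc n) x < hh v (Suc n)" if x: "x \<in> tower n" for n x
  proof -
    obtain i where "i < 4" "index (Suc n) x = index n x + offset v n i"
      using index_Suc[OF x] by metis
    then show ?thesis using index_less[OF x] by (auto simp: offset_def)
  qed
  \<comment> \<open>The bound by \<open>h_n\<close> concerns points of \<open>G_(n-1)\<close>, so
    for points of \<open>tower M\<close> the descent stops at stage \<open>Suc M\<close>.\<close>
  have desc1: "F (Suc n) z = F (Suc n) z' \<longrightarrow> F n z = F n z'"
    if "Suc M \<le> n" "z \<in> tower M \<times> tower M" "z' \<in> tower M \<times> tower M" for n z z'
  proof
    assume eq: "F (Suc n) z = F (Suc n) z'"
    define off where "off i = int (offset v n i)" for i
    have col: "fst z \<in> tower n" "snd z \<in> tower n" "fst z' \<in> tower n" "snd z' \<in> tower n"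
      using that tower_mono[of M n] by (auto simp: mem_Times_iff)
    have pre: "x \<in> tower M \<Longrightarrow> index n x < hh v n" for x
      using hh_bound[of x "n - 1"] tower_mono[of M "n - 1"] that(1) by (cases n) auto
    obtain a b a' b' where ab: "index (Suc n) (fst z) = index n (fst z) + offset v n a"
      "index (Suc n) (snd z) = index n (snd z) + offset v n b"
      "index (Suc n) (fst z') = index n (fst z') + offset v n a'"
      "index (Suc n) (snd z') = index n (snd z') + offset v n b'"
      using index_Suc col by metis
    have M: "M \<le> n" using that(1) by simp
    let ?D = "int (index n (fst z')) - int (index n (fst z))"
    let ?E = "int (index n (snd z')) - int (index n (snd z))"
    have bd: "index n (fst z) < hh v n" "index n (snd z) < hh v n"
      "index n (fst z') < hh v n" "index n (snd z') < hh v n"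
      using pre that by (auto simp: mem_Times_iff)
    have big': "int ((p + q) * hh v n) < int (pp v n)"
      "int ((p + q) * (pp v n + qq v n + 2 * hh v n)) < int (ll v n)" "int (pp v n) \<le> int (qq v n)"
      unfolding of_nat_less_iff of_nat_le_iff using big[OF M] by blast+
    have "int q * ?D = int p * ?E"
    proof (rule offset_descent[where h="int (hh v n)" and P="int (pp v n)" and Q="int (qq v n)"
          and L="int (ll v n)" and off=off])
      show "(int p + int q) * int (hh v n) < int (pp v n)"
        "(int p + int q) * (int (pp v n) + int (qq v n) + 2 * int (hh v n)) < int (ll v n)"
        "int (pp v n) \<le> int (qq v n)"
        using big' by (simp_all only: of_nat_add of_nat_mult of_nat_numeral)
      show "int p * int (qq v n) = int q * int (pp v n) \<or>
        (int p + int q) * int (hh v n) < \<bar>int p * int (qq v n) - int q * int (pp v n)\<bar>"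
        using gap[OF M] by simp
      show "int q * (?D + off a' - off a) = int p * (?E + off b' - off b)"
        using eq unfolding F_def ab off_def by (simp add: algebra_simps)
    qed (use pq bd in \<open>auto simp: off_def offset_def\<close>)
    then show "F n z = F n z'" by (simp add: F_def algebra_simps)
  qed
  have desc: "F (Suc M) z = F (Suc M) z'"
    if "Suc M \<le> n" "F n z = F n z'" "z \<in> tower M \<times> tower M" "z' \<in> tower M \<times> tower M" for n z z'
    using that(1,2)
  proof (induction n rule: dec_induct)
    case (step n)
    then show ?case using desc1[of n z z'] that by blast
  qed auto
  \<comment> \<open>Both cells come from the square of the bottom level of \<open>G_M\<close>; in
    \<open>R1\<close> the second coordinate is taken from the second subcolumn, which changes
    \<open>F (Suc M)\<close> by \<open>- p * p_M\<close>.\<close>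
  define R0 where "R0 = level v (Suc M) 0 \<times> level v (Suc M) 0"
  define R1 where "R1 = level v (Suc M) 0 \<times> level v (Suc M) (pp v M)"
  have lt: "0 < HH v (Suc M)" "pp v M < HH v (Suc M)"
    using HH_pos offset_less[of M 1] by (auto simp: offset_def)
  have R_sub: "R0 \<subseteq> tower M \<times> tower M" "R1 \<subseteq> tower M \<times> tower M"
    using level_Suc_subset[OF HH_pos, of 0 M] level_Suc_subset[OF HH_pos, of 1 M] level_subset[OF HH_pos, of M]
    by (auto simp: R0_def R1_def offset_def)
  have FR: "z \<in> R0 \<Longrightarrow> F (Suc M) z = 0" "z \<in> R1 \<Longrightarrow> F (Suc M) z = - int p * int (pp v M)" for z
    using index_eqI[of _ "Suc M"] lt by (auto simp: R0_def R1_def F_def mem_Times_iff simp del: HH.simps)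
  define V where "V n = F n ` R0" for n
  \<comment> \<open>Written as a finite union of cells, the condition \<open>F n z \<in> V n\<close>
    is visibly measurable.\<close>
  define B where "B n = (\<Union>i<HH v n. \<Union>j\<in>{j. j < HH v n \<and> int q * int i - int p * int j \<in> V n}.
      level v n i \<times> level v n j)" for n
  have B: "z \<in> B n \<longleftrightarrow> z \<in> tower n \<times> tower n \<and> F n z \<in> V n" for z n
  proof
    assume "z \<in> B n"
    then obtain i j where "i < HH v n" "j < HH v n" "int q * int i - int p * int j \<in> V n"
      "fst z \<in> level v n i" "snd z \<in> level v n j" by (auto simp: B_def mem_Times_iff)
    then show "z \<in> tower n \<times> tower n \<and> F n z \<in> V n"
      by (auto simp: F_def index_eqI mem_Times_iff intro: towerI)
  next
    assume "z \<in> tower n \<times> tower n \<and> F n z \<in> V n"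
    then have c: "fst z \<in> tower n" "snd z \<in> tower n" "F n z \<in> V n"
      by (auto simp: mem_Times_iff)
    then have "z \<in> level v n (index n (fst z)) \<times> level v n (index n (snd z))"
      by (simp add: mem_Times_iff index_level)
    then show "z \<in> B n"
      using index_less[OF c(1)] index_less[OF c(2)] c(3) unfolding B_def F_def by blast
  qed
  define A where "A = {z \<in> Xsp v \<times> Xsp v. \<forall>\<^sub>F n in sequentially. z \<in> B n}"
  have "B n \<subseteq> Xsp v \<times> Xsp v" for n
    using tower_subset[of n] by (auto simp: B)
  then have "A = (\<Union>m. \<Inter>n\<in>{m..}. B n)"
    by (auto simp: A_def eventually_sequentially)
  moreover have "B n \<in> sets ?M" for n
    unfolding B_def by (intro sets.finite_UN cell_sets) auto
  ultimately have A: "A \<in> sets ?M"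
    by (auto intro!: sets.countable_UN sets.countable_INT)
  have sp: "space ?M = Xsp v \<times> Xsp v" by (simp add: space_pair_measure space_muX)
  have inv: "prodpow p q -` A \<inter> space ?M = A"
  proof -
    have "prodpow p q z \<in> A \<longleftrightarrow> z \<in> A" if z: "z \<in> Xsp v \<times> Xsp v" for z
    proof -
      obtain x y where xy: "z = (x, y)" by fastforce
      then have X: "x \<in> Xsp v" "y \<in> Xsp v" using z by auto
      note ev = eventually_index_Tv_pow[OF X(1), of p] eventually_index_Tv_pow[OF X(2), of q]
      \<comment> \<open>For large \<open>n\<close> the heights grow by \<open>p\<close> and
        \<open>q\<close>, and \<open>q * p - p * q = 0\<close> leaves \<open>F n\<close>
        unchanged.\<close>
      have "\<forall>\<^sub>F n in sequentially. prodpow p q z \<in> B n \<longleftrightarrow> z \<in> B n"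
        using conjunct2[OF ev(1)] conjunct2[OF ev(2)]
        by eventually_elim (simp add: B xy F_def algebra_simps)
      then have "(\<forall>\<^sub>F n in sequentially. prodpow p q z \<in> B n) \<longleftrightarrow> (\<forall>\<^sub>F n in sequentially. z \<in> B n)"
        by (rule eventually_subst)
      then show ?thesis using ev X by (simp add: A_def xy)
    qed
    then show ?thesis unfolding sp by (auto simp: A_def)
  qed
  have R_sets: "R0 \<in> sets ?M" "R1 \<in> sets ?M"
    unfolding R0_def R1_def using cell_sets lt by auto
  have pos: "0 < emeasure ?M R0" "0 < emeasure ?M R1"
    using prod_sets(3)[OF R_sets(1)] prod_sets(3)[OF R_sets(2)] wid_pos[of "Suc M"]
    by (auto simp: R0_def R1_def cell_emeasure)
  have "R0 \<subseteq> A"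
  proof
    fix z assume z: "z \<in> R0"
    have "z \<in> tower n \<times> tower n" if "M \<le> n" for n
      using subsetD[OF R_sub(1) z] tower_mono[OF that] by (auto simp: mem_Times_iff)
    then have "z \<in> B n" if "M \<le> n" for n using z that by (auto simp: B V_def)
    then show "z \<in> A"
      using subsetD[OF R_sub(1) z] tower_subset[of M] by (auto simp: A_def eventually_sequentially mem_Times_iff)
  qed
  moreover have "R1 \<subseteq> space ?M - A"
  proof
    fix z assume z: "z \<in> R1"
    have "z \<notin> A"
    proof
      assume "z \<in> A"
      then obtain m where "\<And>n. m \<le> n \<Longrightarrow> z \<in> B n" by (auto simp: A_def eventually_sequentially)
      then have "z \<in> B (max m (Suc M))" by simp
      then obtain r where "r \<in> R0" "F (max m (Suc M)) z = F (max m (Suc M)) r"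
        by (auto simp: B V_def)
      then have "F (Suc M) z = F (Suc M) r"
        using desc[of "max m (Suc M)" z r] z R_sub by auto
      then show False
        using FR(1)[OF \<open>r \<in> R0\<close>] FR(2)[OF z] pq(1) heights(1)[of M] by auto
    qed
    then show "z \<in> space ?M - A"
      using subsetD[OF R_sub(2) z] tower_subset[of M] unfolding sp by (auto simp: mem_Times_iff)
  qed
  ultimately have "emeasure ?M R0 \<le> emeasure ?M A" "emeasure ?M R1 \<le> emeasure ?M (space ?M - A)"
    using A by (auto intro!: emeasure_mono)
  moreover have "emeasure ?M A = 0 \<or> emeasure ?M (space ?M - A) = 0"
    using erg A inv unfolding ergodic_def by blast
  ultimately show False using pos by auto
qed

text \<open>Covers \<open>p = q = 0\<close>. Every set is invariant under the identity, so two
  disjoint cells of positive measure suffice.\<close>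

lemma not_ergodic_identity: "\<not> ergodic (muX v \<Otimes>\<^sub>M muX v) id"
proof
  let ?M = "muX v \<Otimes>\<^sub>M muX v"
  let ?A = "level v 1 0 \<times> level v 1 0" and ?B = "level v 1 0 \<times> level v 1 (pp v 0)"
  assume erg: "ergodic ?M id"
  have lt: "0 < HH v 1" "pp v 0 < HH v 1"
    using HH_pos offset_less[of 0 1] by (auto simp: offset_def)
  note R = cell_sets[OF lt(1) lt(1)] cell_sets[OF lt]
  have pos: "0 < emeasure ?M ?A" "0 < emeasure ?M ?B"
    using prod_sets(3)[OF R(1)] prod_sets(3)[OF R(2)] wid_pos[of 1] by (auto simp: cell_emeasure)
  have "?B \<subseteq> space ?M - ?A"
    using sets.sets_into_space[OF R(2)] level_unique[OF _ _ lt] heights(1)[of 0] by fastforce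
  then have "emeasure ?M ?B \<le> emeasure ?M (space ?M - ?A)"
    using R by (intro emeasure_mono) auto
  moreover have "id -` ?A \<inter> space ?M = ?A"
    using sets.sets_into_space[OF R(1)] by auto
  then have "emeasure ?M ?A = 0 \<or> emeasure ?M (space ?M - ?A) = 0"
    using erg R(1) unfolding ergodic_def by blast
  ultimately show False using pos by auto
qed

end

section \<open>Combination of both halves\<close>

lemma conservative_identity: "conservative M id"
  unfolding conservative_def by (auto intro!: exI[of _ 1])

theorem mainTheorem4:
  fixes p q :: nat and v :: rk_params
  assumes "inV v"
    and "infinite {n. int p * int (qq v n) - int q * int (pp v n) = 0}"
    and "finite {n. 0 \<noteq> \<bar>int p * int (qq v n) - int q * int (pp v n)\<bar>
                  \<and> \<bar>int p * int (qq v n) - int q * int (pp v n)\<bar> \<le> int ((p + q) * hh v n)}"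
  shows "conservative (muX v \<Otimes>\<^sub>M muX v) (\<lambda>(x, y). ((Tv v ^^ p) x, (Tv v ^^ q) y))
         \<and> \<not> ergodic (muX v \<Otimes>\<^sub>M muX v) (\<lambda>(x, y). ((Tv v ^^ p) x, (Tv v ^^ q) y))"
proof -
  have W: "inW v" and le: "\<And>n. pp v n \<le> qq v n" using assms(1) by (auto simp: inV_def)
  interpret rank_one v by unfold_locales (use W in \<open>simp add: inW_def\<close>)
  define Z where "Z = {n. p * qq v n = q * pp v n}"
  have "int p * int (qq v n) - int q * int (pp v n) = 0 \<longleftrightarrow> p * qq v n = q * pp v n" for n
    by (metis eq_iff_diff_eq_0 of_nat_eq_iff of_nat_mult)
  then have Z: "infinite Z" using assms(2) by (simp add: Z_def)
  then obtain n0 where "n0 \<in> Z" using infinite_imp_nonempty by blast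
  then have n0: "p * qq v n0 = q * pp v n0" by (simp add: Z_def)
  have P0: "0 < pp v n" "0 < qq v n" for n using heights[of n] by linarith+
  \<comment> \<open>One index with \<open>p * q_n = q * p_n\<close> already forces
    \<open>p \<le> q\<close>, because \<open>p_n \<le> q_n\<close>.\<close>
  have "p * pp v n0 \<le> q * pp v n0" using n0 le[of n0] by (metis mult_le_mono2)
  then have pq: "p \<le> q" using P0(1)[of n0] by simp
  show ?thesis
  proof (cases "p = 0")
    case True
    then have "q = 0" using n0 P0(1)[of n0] by simp
    then show ?thesis
      using True conservative_identity not_ergodic_identity by simp
  next
    case False
    then have p0: "0 < p" by simp
    \<comment> \<open>Only for coprime factors does \<open>p' * q_n = q' * p_n\<close> make
      \<open>p_n\<close> divisible by \<open>p'\<close>, giving the common factor \<open>s\<close>;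
      \<open>conservative_power\<close> returns to \<open>p\<close> and \<open>q\<close>.\<close>
    define g where "g = gcd p q"
    have g0: "0 < g" using p0 by (simp add: g_def)
    define p' q' where "p' = p div g" and "q' = q div g"
    have pq': "p = p' * g" "q = q' * g" by (simp_all add: p'_def q'_def g_def)
    have cop: "coprime p' q'" using p0 by (auto simp: p'_def q'_def g_def div_gcd_coprime)
    have p'0: "0 < p'" using p0 pq' by (cases p') auto
    have "pp v n = p' * (pp v n div p') \<and> qq v n = q' * (pp v n div p')" if "n \<in> Z" for n
    proof -
      have "p' * qq v n * g = q' * pp v n * g"
        using that unfolding Z_def by (simp add: pq' mult.assoc mult.left_commute mult.commute)
      then have e: "p' * qq v n = q' * pp v n" using g0 by simp
      then have "p' dvd q' * pp v n" by (metis dvd_triv_left)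
      then have d: "p' dvd pp v n" using cop coprime_dvd_mult_right_iff by blast
      then obtain s where s: "pp v n = p' * s" by (auto simp: dvd_def)
      have "p' * qq v n = p' * (q' * s)" using e s by (metis mult.left_commute)
      then show ?thesis using s p'0 by auto
    qed
    then have "conservative (muX v \<Otimes>\<^sub>M muX v) (prodpow p' q')"
      by (rule conservative_proportional[OF Z])
    then have cons: "conservative (muX v \<Otimes>\<^sub>M muX v) (prodpow p q)"
      using conservative_power[OF _ measurable_prodpow g0, of p' q']
      unfolding prodpow_funpow pq'[symmetric] by blast
    let ?bad = "{n. 0 \<noteq> \<bar>int p * int (qq v n) - int q * int (pp v n)\<bar>
                  \<and> \<bar>int p * int (qq v n) - int q * int (pp v n)\<bar> \<le> int ((p + q) * hh v n)}"
    obtain M1 where M1: "\<forall>n\<in>?bad. n < M1"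
      using iffD1[OF finite_nat_set_iff_bounded assms(3)] ..
    have hpos: "0 < hh v n" for n using HH_pos[of "n - 1"] by (cases n) auto
    have "\<forall>\<^sub>F n in sequentially. real (p + q) < real (pp v n) / real (hh v n)"
      using W unfolding inW_def filterlim_at_top_dense by blast
    then obtain M2 where "\<And>n. M2 \<le> n \<Longrightarrow> real (p + q) < real (pp v n) / real (hh v n)"
      by (auto simp: eventually_sequentially)
    then have M2: "(p + q) * hh v n < pp v n" if "M2 \<le> n" for n
      using that hpos[of n] pos_less_divide_eq[of "real (hh v n)" "real (p + q)" "real (pp v n)"]
      by (metis of_nat_0_less_iff of_nat_less_iff of_nat_mult)
    have "\<not> ergodic (muX v \<Otimes>\<^sub>M muX v) (prodpow p q)"
    \<comment> \<open>\<open>M1\<close> lies beyond the finitely many small nonzero gaps,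
      \<open>M2\<close> comes from \<open>p_n / h_n\<close> tending to infinity, and
      \<open>n \<ge> p + q\<close> turns the factor \<open>n\<close> in the bound for
      \<open>l_n\<close> into \<open>p + q\<close>.\<close>
    proof (rule not_ergodic_gap[OF p0 pq, of "max M1 (max M2 (p + q))"])
      fix n assume n: "max M1 (max M2 (p + q)) \<le> n"
      have "(p + q) * (pp v n + qq v n + 2 * hh v n) \<le> n * (pp v n + qq v n + 2 * hh v n)"
        using n by (intro mult_le_mono1) simp
      also have "\<dots> < ll v n" using W by (simp add: inW_def)
      finally show "pp v n \<le> qq v n \<and> (p + q) * hh v n < pp v n
          \<and> (p + q) * (pp v n + qq v n + 2 * hh v n) < ll v n"
        using le M2 n by simp
      have "n \<notin> ?bad" using bspec[OF M1, of n] n by linarith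
      then show "int p * int (qq v n) = int q * int (pp v n)
          \<or> int ((p + q) * hh v n) < \<bar>int p * int (qq v n) - int q * int (pp v n)\<bar>"
        by auto
    qed
    with cons show ?thesis by blast
  qed
qed

end
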